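(* Consider, for each scaling parameter $\eta>0$, the scaled Erlang-A queue with constant rates described in the context, with queue length $Q^\eta$, arrival process $N^\eta$ and virtual waiting time $W^\eta(t)$. Let $$O^\eta(t)=N^\eta\left(t+\mathcal{S}+W^\eta(t)\right)-N^\eta(t)+Q^\eta(t)$$ be the scaled number of people that a (virtual, non-abandoning) customer who arrives at time $t$ will overlap with. Then $$\lim_{\eta\to\infty}\frac1\eta\,\mathbb{E}\left[O^\eta(t)\right]=\frac{\lambda}{\mu}+\frac{\lambda}{\theta}\log\left(1+\frac{\theta\,(q(t)-c)^+}{\mu c}\right)+q(t),$$ where $q(t)$ is the solution of $$\dot q(t)=\lambda-\mu\,(q(t)\wedge c)-\theta\,(q(t)-c)^+ .$$ Moreover, when $t\to\infty$, $$\lim_{t\to\infty}\lim_{\eta\to\infty}\frac1\eta\,\mathbb{E}\left[O^\eta(t)\right]=\begin{cases}\dfrac{2\lambda}{\mu}, & \text{if }\lambda\le\mu c,\\[2mm] \dfrac{\lambda}{\mu}+\dfrac{\lambda}{\theta}\log\left(\dfrac{\lambda}{\mu c}\right)+c+\dfrac{\lambda-\mu c}{\theta}, & \text{if }\lambda>\mu c.\end{cases}$$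
   Context: Notation: $x\wedge y=\min\{x,y\}$, $x^+=\max\{x,0\}$; $\lambda,\mu,\theta>0$ are constants and $c$ is a positive integer. Scaled Erlang-A queue: arrivals form a Poisson process $N^\eta(t)=\Pi_1(\eta\lambda t)$; there are $\eta c$ servers, each with exponential service times of rate $\mu$; each waiting customer abandons after an exponential time of rate $\theta$. The number in system $Q^\eta$ satisfies $$Q^\eta(t)=Q^\eta(0)+\Pi_1(\eta\lambda t)-\Pi_2\left(\int_0^t\mu\,(Q^\eta(s)\wedge\eta c)\,ds\right)-\Pi_3\left(\int_0^t\theta\,(Q^\eta(s)-\eta c)^+\,ds\right),$$ where $\Pi_1,\Pi_2,\Pi_3$ are independent rate-1 Poisson processes. The function $q$ is the fluid limit of the queue length: $\lim_{\eta\to\infty}\frac1\eta Q^\eta(t)=q(t)$ almost surely, in particular at $t=0$. Virtual customer: $W^\eta(t)$ is the time that a virtual customer arriving at time $t$, who is not going to abandon, waits before beginning service. It is zero if a server is free; if all servers are busy and $k\ge0$ customers are waiting ahead, it is distributed as $\sum_{j=0}^k Y_j$ with independent $Y_j\sim\mathrm{Exp}(\mu\eta c+\theta j)$; it depends only on the customers already present, not on arrivals after time $t$. The service time $\mathcal{S}$ of the virtual customer is exponential with rate $\mu$ and independent of the rest.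
   Formalization: The formal theorem also assumes that Q^η(0) is integrable for every η>0 and that E[Q^η(0)]/η → q(0); almost sure convergence of Q^η(0)/η alone does not suffice, e.g. if Q^η(0)=⌊η⌋^4 on an independent event of probability ⌊η⌋^(-2). *)

theory Defs
  imports "HOL-Probability.Probability"
begin

definition (in prob_space) poisson_process :: "real \<Rightarrow> (real \<Rightarrow> 'a \<Rightarrow> nat) \<Rightarrow> bool" where
  "poisson_process r N \<longleftrightarrow>
     (\<forall>t\<ge>0. random_variable (count_space UNIV) (N t)) \<and>
     (\<forall>\<omega>\<in>space M. N 0 \<omega> = 0 \<and> mono_on {0..} (\<lambda>t. N t \<omega>) \<and>
        (\<forall>t\<ge>0. continuous (at_right t) (\<lambda>u. real (N u \<omega>)))) \<and>
     (\<forall>(n::nat) \<tau>::nat \<Rightarrow> real. 0 \<le> \<tau> 0 \<longrightarrow> mono \<tau> \<longrightarrow>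
        indep_vars (\<lambda>_. count_space UNIV) (\<lambda>i \<omega>. N (\<tau> (Suc i)) \<omega> - N (\<tau> i) \<omega>) {..<n}) \<and>
     (\<forall>s t. 0 \<le> s \<longrightarrow> s < t \<longrightarrow>
        distr M (count_space UNIV) (\<lambda>\<omega>. N t \<omega> - N s \<omega>) = measure_pmf (poisson_pmf (r * (t - s))))"

text \<open>
  The library's \<open>indep_var\<close> requires both variables to have the same value type.
\<close>
definition (in prob_space) indep_rvs ::
    "'b measure \<Rightarrow> ('a \<Rightarrow> 'b) \<Rightarrow> 'c measure \<Rightarrow> ('a \<Rightarrow> 'c) \<Rightarrow> bool" where
  "indep_rvs N X L Y \<longleftrightarrow> random_variable N X \<and> random_variable L Y \<and>
     indep_set (sets (vimage_algebra (space M) X N)) (sets (vimage_algebra (space M) Y L))"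

text \<open>
  The law of the virtual waiting time when \<open>n\<close> customers are in the system and there are \<open>s\<close>
  servers: the point mass at 0 if a server is free, otherwise the law of the sum of independent
  \<open>Y\<^sub>j\<close>, exponential with rate \<open>\<mu> s + \<theta> j\<close>, for \<open>j = 0, \<dots>, k\<close>, where \<open>k\<close> customers are waiting.
  The number \<open>s\<close> is a real because the scaling parameter is; the floor only matters when \<open>s\<close> is not
  an integer.
\<close>
definition virtual_wait_law :: "real \<Rightarrow> real \<Rightarrow> real \<Rightarrow> nat \<Rightarrow> real measure" where
  "virtual_wait_law \<mu> \<theta> s n =
     (if real n < s then return borel 0
      else let k = nat \<lfloor>real n - s\<rfloor> in
        distr (\<Pi>\<^sub>M j\<in>{0..k}. density lborel (exponential_density (\<mu> * s + \<theta> * real j))) borel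
          (\<lambda>y. \<Sum>j\<in>{0..k}. y j))"

text \<open>
  \<open>P 1\<close>, \<open>P 2\<close>, \<open>P 3\<close> are the driving unit-rate Poisson processes, common to all values of the scaling
  parameter \<open>\<eta>\<close>; \<open>Q \<eta> t\<close> is the number in system, \<open>W \<eta> t\<close> the virtual waiting time and \<open>S\<close> the
  service time of the virtual customer.
\<close>
locale scaled_erlang_a = prob_space M
  for M :: "'a measure" +
  fixes lam \<mu> \<theta> :: real and c :: nat
    and P :: "nat \<Rightarrow> real \<Rightarrow> 'a \<Rightarrow> nat"
    and Q :: "real \<Rightarrow> real \<Rightarrow> 'a \<Rightarrow> nat"
    and W :: "real \<Rightarrow> real \<Rightarrow> 'a \<Rightarrow> real"
    and S :: "'a \<Rightarrow> real"
  assumes rates_pos: "lam > 0" "\<mu> > 0" "\<theta> > 0"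
    and servers_pos: "c > 0"
    and poisson: "\<And>i. i \<in> {1, 2, 3} \<Longrightarrow> poisson_process 1 (P i)"
    and poisson_indep:
      "indep_vars (\<lambda>_. \<Pi>\<^sub>M u\<in>{0..}. count_space UNIV) (\<lambda>i \<omega>. \<lambda>u\<in>{0..}. P i u \<omega>) {1, 2, 3}"
    and Q_measurable:
      "\<And>\<eta> t. \<eta> > 0 \<Longrightarrow> t \<ge> 0 \<Longrightarrow> random_variable (count_space UNIV) (Q \<eta> t)"
    \<comment> \<open>The integrals in the queue equation exist, so that \<open>integral\<close> does not default to 0.\<close>
    and Q_paths_integrable:
      "\<And>\<eta>. \<eta> > 0 \<Longrightarrow> AE \<omega> in M. \<forall>t\<ge>0. (\<lambda>s. real (Q \<eta> s \<omega>)) integrable_on {0..t}"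
    and Q_equation:
      "\<And>\<eta>. \<eta> > 0 \<Longrightarrow> AE \<omega> in M. \<forall>t\<ge>0.
         real (Q \<eta> t \<omega>) = real (Q \<eta> 0 \<omega>) + real (P 1 (\<eta> * lam * t) \<omega>)
           - real (P 2 (integral {0..t} (\<lambda>s. \<mu> * min (real (Q \<eta> s \<omega>)) (\<eta> * real c))) \<omega>)
           - real (P 3 (integral {0..t} (\<lambda>s. \<theta> * max (real (Q \<eta> s \<omega>) - \<eta> * real c) 0)) \<omega>)"
    and W_measurable: "\<And>\<eta> t. \<eta> > 0 \<Longrightarrow> t \<ge> 0 \<Longrightarrow> random_variable borel (W \<eta> t)"
    and W_nonneg: "\<And>\<eta> t \<omega>. \<eta> > 0 \<Longrightarrow> t \<ge> 0 \<Longrightarrow> \<omega> \<in> space M \<Longrightarrow> W \<eta> t \<omega> \<ge> 0"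
    \<comment> \<open>The conditional law of \<open>W \<eta> t\<close> given \<open>Q \<eta> t = n\<close>.\<close>
    and W_law:
      "\<And>\<eta> t n B. \<eta> > 0 \<Longrightarrow> t \<ge> 0 \<Longrightarrow> B \<in> sets borel \<Longrightarrow>
         prob {\<omega> \<in> space M. Q \<eta> t \<omega> = n \<and> W \<eta> t \<omega> \<in> B} =
         prob {\<omega> \<in> space M. Q \<eta> t \<omega> = n} * measure (virtual_wait_law \<mu> \<theta> (\<eta> * real c) n) B"
    and W_indep_future_arrivals:
      "\<And>\<eta> t. \<eta> > 0 \<Longrightarrow> t \<ge> 0 \<Longrightarrow>
         indep_rvs borel (W \<eta> t) (\<Pi>\<^sub>M u\<in>{0..}. count_space UNIV)
           (\<lambda>\<omega>. \<lambda>u\<in>{0..}. P 1 (\<eta> * lam * (t + u)) \<omega> - P 1 (\<eta> * lam * t) \<omega>)"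
    and S_nonneg: "\<And>\<omega>. \<omega> \<in> space M \<Longrightarrow> S \<omega> \<ge> 0"
    and S_exponential: "distributed M lborel S (exponential_density \<mu>)"
    and S_indep:
      "\<And>\<eta>. \<eta> > 0 \<Longrightarrow>
         indep_rvs borel S
           (\<Pi>\<^sub>M u\<in>{0..}. count_space UNIV \<Otimes>\<^sub>M count_space UNIV \<Otimes>\<^sub>M count_space UNIV
              \<Otimes>\<^sub>M count_space UNIV \<Otimes>\<^sub>M borel)
           (\<lambda>\<omega>. \<lambda>u\<in>{0..}. (P 1 u \<omega>, P 2 u \<omega>, P 3 u \<omega>, Q \<eta> u \<omega>, W \<eta> u \<omega>))"
begin

definition arrivals :: "real \<Rightarrow> real \<Rightarrow> 'a \<Rightarrow> nat" where
  "arrivals \<eta> t \<omega> = P 1 (\<eta> * lam * t) \<omega>"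

definition overlap :: "real \<Rightarrow> real \<Rightarrow> 'a \<Rightarrow> real" where
  "overlap \<eta> t \<omega> =
     real (arrivals \<eta> (t + S \<omega> + W \<eta> t \<omega>) \<omega>) - real (arrivals \<eta> t \<omega>) + real (Q \<eta> t \<omega>)"

end

end

theory Submission
  imports Defs "HOL-Real_Asymp.Real_Asymp"
begin

text \<open>
  By the law of large numbers for the driving Poisson processes, the scaled queue
  \<open>X = Q \<eta> / \<eta>\<close> satisfies the integrated fluid equation up to an error that vanishes uniformly on
  compact time intervals. As the drift is Lipschitz, this gives
  \<open>\<bar>q u - q s - (u - s) q'(s)\<bar> \<le> C (u - s)\<^sup>2\<close>, hence the differential equation.

  The domination \<open>Q \<eta> t \<le> Q \<eta> 0 + P 1 (\<eta> \<lambda> t)\<close> together with the convergence of the means of the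
  dominating variable makes \<open>Q \<eta> t / \<eta>\<close> converge to \<open>q t\<close> in \<open>L\<^sup>1\<close>. The conditional mean of the virtual
  waiting time is a sum \<open>\<Sum>\<^sub>j 1 / (\<mu> \<eta> c + \<theta> j)\<close>, which differs from the logarithm in the limit, a
  Lipschitz function of \<open>Q \<eta> t / \<eta>\<close>, by at most \<open>1 / (\<mu> \<eta> c)\<close>. Finally, the arrivals after \<open>t\<close> are
  independent of \<open>S + W \<eta> t\<close>, so their mean number during that time is \<open>\<eta> \<lambda> E[S + W \<eta> t]\<close>.

  For \<open>t \<rightarrow> \<infinity>\<close>, the squared distance of \<open>q\<close> to the equilibrium decays exponentially, because the
  drift decreases at least at rate \<open>min \<mu> \<theta>\<close>.
\<close>

section \<open>Poisson processes\<close>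

text \<open>The obstacle is that the fluid limit is given pointwise: its null set depends on the
  time, and nothing is said about continuity or measurability of \<open>q\<close>. So no limit is
  ever taken under a time integral. Instead each prelimit path is shown to move over a short
  interval by at most a Lipschitz term plus a vanishing error; this controls its drain there, and
  \<open>q\<close> inherits an estimate that mentions only finitely many times.

  The overlap is the sum of an arrival count and the queue length, so the joint law of these two
  never matters. What remains is one independence statement, for the later arrivals and
  \<open>S + W \<eta> t\<close>.

  The wait is described only by its conditional law given the queue length, so its mean is what is
  tracked and no pathwise limit of the wait is used. The error in the conditional mean is uniform in
  the queue length, which lets it pass through the expectation.\<close>

lemma poisson_pmf_sums:
  fixes r :: real
  defines "p \<equiv> \<lambda>k::nat. r ^ k / fact k * exp (- r)"
  shows "p sums 1" "(\<lambda>k. p k * real k) sums r" "(\<lambda>k. p k * (real k - r)\<^sup>2) sums r"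
proof -
  have "(\<lambda>k. r ^ k /\<^sub>R fact k * exp (- r)) sums (exp r * exp (- r))"
    by (intro sums_mult2 exp_converges)
  then show p0: "p sums 1"
    by (simp add: p_def divide_inverse mult_ac exp_minus)
  \<comment> \<open>Multiplying by \<open>k\<close> shifts the Poisson weights, so each moment
    reduces to the previous one. The term at \<open>k = 0\<close> vanishes, hence
    \<open>sums_Suc_iff\<close> restores the full series without a correction.\<close>
  have Suc1: "p (Suc k) * real (Suc k) = r * p k" for k
    by (simp add: p_def divide_simps)
  have "(\<lambda>k. p (Suc k) * real (Suc k)) sums (r * 1)"
    unfolding Suc1 by (intro sums_mult p0)
  then show p1: "(\<lambda>k. p k * real k) sums r"
    by (subst (asm) sums_Suc_iff) simp
  have Suc2: "p (Suc k) * (real (Suc k))\<^sup>2 = r * (p k * real k) + r * p k" for k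
  proof -
    have "p (Suc k) * (real (Suc k))\<^sup>2 = (p (Suc k) * real (Suc k)) * (real k + 1)"
      by (simp add: power2_eq_square)
    then show ?thesis unfolding Suc1 by (simp add: algebra_simps)
  qed
  have "(\<lambda>k. p (Suc k) * (real (Suc k))\<^sup>2) sums (r * r + r * 1)"
    unfolding Suc2 by (intro sums_add sums_mult p0 p1)
  then have p2: "(\<lambda>k. p k * (real k)\<^sup>2) sums (r * r + r)"
    by (subst (asm) sums_Suc_iff) simp
  have "(\<lambda>k. p k * (real k)\<^sup>2 - 2 * r * (p k * real k) + r\<^sup>2 * p k) sums (r * r + r - 2 * r * r + r\<^sup>2 * 1)"
    by (intro sums_add sums_diff sums_mult p0 p1 p2)
  then show "(\<lambda>k. p k * (real k - r)\<^sup>2) sums r"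
    by (simp add: power2_eq_square algebra_simps)
qed

lemma nn_integral_pmf_nat_sums:
  fixes p :: "nat pmf"
  assumes "(\<lambda>k. pmf p k * f k) sums x" "\<And>k. 0 \<le> f k"
  shows "(\<integral>\<^sup>+ k. ennreal (f k) \<partial>measure_pmf p) = ennreal x"
proof -
  have "(\<integral>\<^sup>+ k. ennreal (f k) \<partial>measure_pmf p) = (\<Sum>k. ennreal (pmf p k * f k))"
    using assms(2) by (simp add: nn_integral_measure_pmf nn_integral_count_space_nat ennreal_mult'')
  also have "\<dots> = ennreal x"
    by (intro suminf_ennreal_eq assms mult_nonneg_nonneg pmf_nonneg)
  finally show ?thesis .
qed

context prob_space
begin

lemma poisson_processD:
  assumes "poisson_process r N"
  shows "\<And>t. 0 \<le> t \<Longrightarrow> N t \<in> measurable M (count_space UNIV)"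
    and "\<And>\<omega>. \<omega> \<in> space M \<Longrightarrow> N 0 \<omega> = 0"
    and "\<And>\<omega> s t. \<omega> \<in> space M \<Longrightarrow> 0 \<le> s \<Longrightarrow> s \<le> t \<Longrightarrow> N s \<omega> \<le> N t \<omega>"
    and "\<And>\<omega> t. \<omega> \<in> space M \<Longrightarrow> 0 \<le> t \<Longrightarrow> continuous (at_right t) (\<lambda>u. real (N u \<omega>))"
    and "\<And>s t. 0 \<le> s \<Longrightarrow> s < t \<Longrightarrow>
        distr M (count_space UNIV) (\<lambda>\<omega>. N t \<omega> - N s \<omega>) = measure_pmf (poisson_pmf (r * (t - s)))"
  using assms unfolding poisson_process_def by (auto simp: mono_on_def)

text \<open>Mean and variance of a Poisson law coincide, so one computation serves both claims.
  Integrals in \<open>[0, \<infinity>]\<close> need no prior proof of integrability.\<close>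

lemma poisson_process_increment_nn_integral:
  assumes N: "poisson_process r N" and "0 < r" "0 \<le> s" "s \<le> t"
  shows "(\<integral>\<^sup>+ \<omega>. ennreal (real (N t \<omega> - N s \<omega>)) \<partial>M) = ennreal (r * (t - s))"
    and "(\<integral>\<^sup>+ \<omega>. ennreal ((real (N t \<omega> - N s \<omega>) - r * (t - s))\<^sup>2) \<partial>M) = ennreal (r * (t - s))"
proof -
  note [measurable] = poisson_processD(1)[OF N]
  have distr: "(\<integral>\<^sup>+ \<omega>. ennreal (f (N t \<omega> - N s \<omega>)) \<partial>M) = ennreal (r * (t - s))"
    if "f = real \<or> f = (\<lambda>k. (real k - r * (t - s))\<^sup>2)" for f :: "nat \<Rightarrow> real"
  \<comment> \<open>The definition prescribes the law of an increment only for \<open>s < t\<close>;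
    for \<open>s = t\<close> both integrands are 0.\<close>
  proof (cases "s = t")
    case True
    then show ?thesis using that by auto
  next
    case False
    then have pos: "r * (t - s) > 0" using assms by simp
    note N' = poisson_processD(5)[OF N \<open>0 \<le> s\<close>, of t]
    have [measurable]: "N t \<in> measurable M (count_space UNIV)" "N s \<in> measurable M (count_space UNIV)"
      using assms by auto
    have "(\<integral>\<^sup>+ \<omega>. ennreal (f (N t \<omega> - N s \<omega>)) \<partial>M) =
        (\<integral>\<^sup>+ k. ennreal (f k) \<partial>distr M (count_space UNIV) (\<lambda>\<omega>. N t \<omega> - N s \<omega>))"
      by (subst nn_integral_distr) auto
    also have "\<dots> = ennreal (r * (t - s))"
      using that pos poisson_pmf_sums[of "r * (t - s)"] False assms
      by (subst N') (auto intro!: nn_integral_pmf_nat_sums)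
    finally show ?thesis .
  qed
  from distr[of real] distr[of "\<lambda>k. (real k - r * (t - s))\<^sup>2"]
  show "(\<integral>\<^sup>+ \<omega>. ennreal (real (N t \<omega> - N s \<omega>)) \<partial>M) = ennreal (r * (t - s))"
    "(\<integral>\<^sup>+ \<omega>. ennreal ((real (N t \<omega> - N s \<omega>) - r * (t - s))\<^sup>2) \<partial>M) = ennreal (r * (t - s))"
    by simp_all
qed

lemma poisson_process_mean:
  assumes N: "poisson_process r N" and "0 < r" "0 \<le> t"
  shows "integrable M (\<lambda>\<omega>. real (N t \<omega>))" "expectation (\<lambda>\<omega>. real (N t \<omega>)) = r * t"
proof -
  note [measurable] = poisson_processD(1)[OF N \<open>0 \<le> t\<close>]
  have "(\<integral>\<^sup>+ \<omega>. ennreal (real (N t \<omega>)) \<partial>M) = (\<integral>\<^sup>+ \<omega>. ennreal (real (N t \<omega> - N 0 \<omega>)) \<partial>M)"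
    by (intro nn_integral_cong) (simp add: poisson_processD(2)[OF N])
  also have "\<dots> = ennreal (r * t)"
    using poisson_process_increment_nn_integral(1)[OF N, of 0 t] assms by simp
  finally have eq: "(\<integral>\<^sup>+ \<omega>. ennreal (real (N t \<omega>)) \<partial>M) = ennreal (r * t)" .
  then have "has_bochner_integral M (\<lambda>\<omega>. real (N t \<omega>)) (r * t)"
    by (intro has_bochner_integral_nn_integral) (use assms in auto)
  then show "integrable M (\<lambda>\<omega>. real (N t \<omega>))" "expectation (\<lambda>\<omega>. real (N t \<omega>)) = r * t"
    by (auto simp: has_bochner_integral_iff)
qed

text \<open>The second moments are summable along the squares \<open>n\<^sup>2\<close>; monotonicity fills the gaps.\<close>
lemma poisson_process_lln:
  assumes N: "poisson_process 1 N"
  shows "AE \<omega> in M. ((\<lambda>y. real (N y \<omega>) / y) \<longlongrightarrow> 1) at_top"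
proof -
  define n where "n k = (real (Suc k))\<^sup>2" for k :: nat
  define g where "g k \<omega> = (real (N (n k) \<omega>) / n k - 1)\<^sup>2" for k \<omega>
  have n_pos: "n k > 0" for k by (simp add: n_def)
  have [measurable]: "N (n k) \<in> measurable M (count_space UNIV)" for k
    using poisson_processD(1)[OF N] n_pos[of k] by auto
  have [measurable]: "g k \<in> borel_measurable M" for k unfolding g_def[abs_def] by measurable
  have g: "(\<integral>\<^sup>+ \<omega>. ennreal (g k \<omega>) \<partial>M) = ennreal (1 / (real (Suc k))\<^sup>2)" for k
  proof -
    have "(\<integral>\<^sup>+ \<omega>. ennreal (g k \<omega>) \<partial>M) =
        (\<integral>\<^sup>+ \<omega>. ennreal (1 / (n k)\<^sup>2) * ennreal ((real (N (n k) \<omega> - N 0 \<omega>) - 1 * (n k - 0))\<^sup>2) \<partial>M)"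
    proof (intro nn_integral_cong, goal_cases)
      case (1 \<omega>)
      have "g k \<omega> = 1 / (n k)\<^sup>2 * (real (N (n k) \<omega>) - n k)\<^sup>2"
        using n_pos[of k] by (simp add: g_def power2_eq_square field_simps)
      then show ?case using poisson_processD(2)[OF N 1] by (simp flip: ennreal_mult)
    qed
    also have "\<dots> = ennreal (1 / (n k)\<^sup>2) * ennreal (1 * (n k - 0))"
    proof -
      have [measurable]: "N 0 \<in> measurable M (count_space UNIV)"
        using poisson_processD(1)[OF N] by auto
      show ?thesis
      using poisson_process_increment_nn_integral(2)[OF N, of 0 "n k"] n_pos[of k]
      by (subst nn_integral_cmult) auto
    qed
    also have "\<dots> = ennreal (1 / (real (Suc k))\<^sup>2)"
      using n_pos[of k] by (simp add: n_def power2_eq_square divide_simps flip: ennreal_mult'')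
    finally show ?thesis .
  qed
  \<comment> \<open>The sum of the expectations is finite, so the random series converges almost
    surely and its terms tend to 0. This takes the place of Chebyshev's inequality with
    Borel-Cantelli.\<close>
  have sq: "summable (\<lambda>k. 1 / (real (Suc k))\<^sup>2)"
    using inverse_squares_sums by (auto simp: sums_iff)
  have "(\<integral>\<^sup>+ \<omega>. (\<Sum>k. ennreal (g k \<omega>)) \<partial>M) = (\<Sum>k. ennreal (1 / (real (Suc k))\<^sup>2))"
    by (subst nn_integral_suminf) (auto simp: g)
  also have "\<dots> < top"
    using sq by (subst suminf_ennreal2) auto
  finally have "AE \<omega> in M. (\<Sum>k. ennreal (g k \<omega>)) \<noteq> \<infinity>"
    by (intro nn_integral_PInf_AE) auto
  then have "AE \<omega> in M. (\<lambda>k. real (N (n k) \<omega>) / n k) \<longlonglongrightarrow> 1"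
  proof eventually_elim
    case (elim \<omega>)
    then have "summable (\<lambda>k. g k \<omega>)"
      by (intro summable_suminf_not_top) (auto simp: g_def)
    then have "(\<lambda>k. sqrt (g k \<omega>)) \<longlonglongrightarrow> sqrt 0"
      by (intro tendsto_real_sqrt summable_LIMSEQ_zero)
    then have "(\<lambda>k. real (N (n k) \<omega>) / n k - 1) \<longlonglongrightarrow> 0"
      by (simp add: g_def tendsto_rabs_zero_iff)
    then show ?case by (simp add: LIM_zero_iff)
  qed
  with AE_space show ?thesis
  proof eventually_elim
    case (elim \<omega>)
    note mono = poisson_processD(3)[OF N \<open>\<omega> \<in> space M\<close>]
    \<comment> \<open>Since \<open>n k\<close> is the square of \<open>k + 1\<close>,
      \<open>n (m y - 1)\<close> and \<open>n (m y)\<close> are the consecutive squares around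
      \<open>y\<close>. The truncated subtraction is harmless because \<open>m y\<close> is at least
      1 for \<open>y \<ge> 1\<close>.\<close>
    define m where "m y = nat \<lfloor>sqrt y\<rfloor>" for y :: real
    have m_top: "filterlim m at_top at_top"
      unfolding m_def by (intro filterlim_compose[OF filterlim_nat_sequentially]
        filterlim_compose[OF filterlim_floor_sequentially] sqrt_at_top)
    have m1_top: "filterlim (\<lambda>y. m y - 1) at_top at_top"
      by (rule filterlim_compose[OF filterlim_minus_const_nat_at_top m_top])
    have *: "((\<lambda>y. real (N (n (m y)) \<omega>) / n (m y)) \<longlongrightarrow> 1) at_top"
      "((\<lambda>y. real (N (n (m y - 1)) \<omega>) / n (m y - 1)) \<longlongrightarrow> 1) at_top"
      using filterlim_compose[OF elim(2) m_top] filterlim_compose[OF elim(2) m1_top] by auto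
    \<comment> \<open>Consecutive squares around \<open>y\<close> differ from \<open>y\<close> by a
      factor that tends to 1; this is why the sparse subsequence loses nothing.\<close>
    have r: "((\<lambda>y. (sqrt y + 1)\<^sup>2 / y) \<longlongrightarrow> 1) at_top" "((\<lambda>y. (sqrt y - 1)\<^sup>2 / y) \<longlongrightarrow> 1) at_top"
      by real_asymp+
    have bnd: "n (m y) \<le> (sqrt y + 1)\<^sup>2" "y \<le> n (m y)" "(sqrt y - 1)\<^sup>2 \<le> n (m y - 1)" "n (m y - 1) \<le> y"
      if "y \<ge> 1" for y
    proof -
      have s: "1 \<le> sqrt y" using that by simp
      then have m: "real (m y) \<le> sqrt y" "sqrt y \<le> real (m y) + 1" "1 \<le> m y"
        unfolding m_def by (linarith, linarith, linarith)
      have y: "y = (sqrt y)\<^sup>2" using that by simp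
      show "n (m y) \<le> (sqrt y + 1)\<^sup>2" unfolding n_def using m by (intro power_mono) auto
      show "y \<le> n (m y)" unfolding n_def by (subst y, intro power_mono) (use m s in auto)
      show "(sqrt y - 1)\<^sup>2 \<le> n (m y - 1)" unfolding n_def using m s by (intro power_mono) auto
      show "n (m y - 1) \<le> y" unfolding n_def by (subst (2) y, intro power_mono) (use m s in auto)
    qed
    show ?case
    proof (rule tendsto_sandwich)
      show "((\<lambda>y. real (N (n (m y - 1)) \<omega>) / n (m y - 1) * ((sqrt y - 1)\<^sup>2 / y)) \<longlongrightarrow> 1) at_top"
        using tendsto_mult[OF *(2) r(2)] by simp
      show "((\<lambda>y. real (N (n (m y)) \<omega>) / n (m y) * ((sqrt y + 1)\<^sup>2 / y)) \<longlongrightarrow> 1) at_top"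
        using tendsto_mult[OF *(1) r(1)] by simp
      show "\<forall>\<^sub>F y in at_top. real (N (n (m y - 1)) \<omega>) / n (m y - 1) * ((sqrt y - 1)\<^sup>2 / y) \<le> real (N y \<omega>) / y"
        using eventually_ge_at_top[of 1]
      proof eventually_elim
        case (elim y)
        have "real (N (n (m y - 1)) \<omega>) / n (m y - 1) * (sqrt y - 1)\<^sup>2 \<le>
            real (N (n (m y - 1)) \<omega>) / n (m y - 1) * n (m y - 1)"
          using bnd[OF elim] n_pos[of "m y - 1"] by (intro mult_left_mono) auto
        also have "\<dots> = real (N (n (m y - 1)) \<omega>)"
          using n_pos[of "m y - 1"] by simp
        also have "\<dots> \<le> real (N y \<omega>)"
          using mono[of "n (m y - 1)" y] bnd[OF elim] n_pos[of "m y - 1"] by simp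
        finally show ?case
          using elim divide_right_mono[of "real (N (n (m y - 1)) \<omega>) / n (m y - 1) * (sqrt y - 1)\<^sup>2" "real (N y \<omega>)" y]
          by (simp only: times_divide_eq_right)
      qed
      show "\<forall>\<^sub>F y in at_top. real (N y \<omega>) / y \<le> real (N (n (m y)) \<omega>) / n (m y) * ((sqrt y + 1)\<^sup>2 / y)"
        using eventually_ge_at_top[of 1]
      proof eventually_elim
        case (elim y)
        have "real (N y \<omega>) \<le> real (N (n (m y)) \<omega>)"
          using mono[of y "n (m y)"] bnd[OF elim] elim by simp
        also have "\<dots> = real (N (n (m y)) \<omega>) / n (m y) * n (m y)"
          using n_pos[of "m y"] by simp
        also have "\<dots> \<le> real (N (n (m y)) \<omega>) / n (m y) * (sqrt y + 1)\<^sup>2"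
          using bnd[OF elim] n_pos[of "m y"] by (intro mult_left_mono) auto
        finally show ?case
          using elim divide_right_mono[of "real (N y \<omega>)" "real (N (n (m y)) \<omega>) / n (m y) * (sqrt y + 1)\<^sup>2" y]
          by (simp only: times_divide_eq_right)
      qed
    qed
  qed
qed

end

section \<open>A counting process at an independent time\<close>

context prob_space
begin

text \<open>A function of \<open>X\<close> generates a sub-sigma-algebra of that of
  \<open>X\<close>, and independence passes to smaller families.\<close>

lemma indep_rvs_compose:
  assumes ind: "indep_rvs N X L Y" and f: "f \<in> measurable N N'" and g: "g \<in> measurable L L'"
  shows "indep_rvs N' (\<lambda>\<omega>. f (X \<omega>)) L' (\<lambda>\<omega>. g (Y \<omega>))"
proof -
  have X: "X \<in> measurable M N" and Y: "Y \<in> measurable M L"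
    and i: "indep_set (sets (vimage_algebra (space M) X N)) (sets (vimage_algebra (space M) Y L))"
    using ind by (auto simp: indep_rvs_def)
  have sub: "sets (vimage_algebra (space M) (\<lambda>\<omega>. h (Z \<omega>)) K') \<subseteq> sets (vimage_algebra (space M) Z K)"
    if Z: "Z \<in> measurable M K" and h: "h \<in> measurable K K'" for h Z K K'
  proof -
    have "Z \<in> measurable (vimage_algebra (space M) Z K) K"
      using measurable_space[OF Z] by (intro measurable_vimage_algebra1) auto
    then have "(\<lambda>\<omega>. h (Z \<omega>)) \<in> measurable (vimage_algebra (space M) Z K) K'"
      using h by measurable
    from measurable_sets[OF this] show ?thesis
      using measurable_space[OF h] measurable_space[OF Z] by (auto simp: sets_vimage_algebra2)
  qed
  have "indep_set (sets (vimage_algebra (space M) (\<lambda>\<omega>. f (X \<omega>)) N'))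
     (sets (vimage_algebra (space M) (\<lambda>\<omega>. g (Y \<omega>)) L'))"
    using indep_sets_mono_sets[OF i[unfolded indep_set_def]] sub[OF X f] sub[OF Y g]
    unfolding indep_set_def by (auto split: bool.splits)
  then show ?thesis
    using X Y f g unfolding indep_rvs_def by auto
qed

text \<open>Independence is the product formula on rectangles, and these determine a product of
  finite measures. In this form Fubini becomes applicable.\<close>

lemma indep_rvs_distr:
  assumes ind: "indep_rvs N X L Y"
  shows "distr M (N \<Otimes>\<^sub>M L) (\<lambda>\<omega>. (X \<omega>, Y \<omega>)) = distr M N X \<Otimes>\<^sub>M distr M L Y"
proof -
  have X[measurable]: "X \<in> measurable M N" and Y[measurable]: "Y \<in> measurable M L"
    and i: "indep_set (sets (vimage_algebra (space M) X N)) (sets (vimage_algebra (space M) Y L))"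
    using ind by (auto simp: indep_rvs_def)
  interpret X: prob_space "distr M N X" by (rule prob_space_distr) fact
  interpret Y: prob_space "distr M L Y" by (rule prob_space_distr) fact
  have "distr M N X \<Otimes>\<^sub>M distr M L Y = distr M (N \<Otimes>\<^sub>M L) (\<lambda>\<omega>. (X \<omega>, Y \<omega>))"
  proof (rule pair_measure_eqI)
    fix A B assume A: "A \<in> sets (distr M N X)" and B: "B \<in> sets (distr M L Y)"
    then have [measurable]: "A \<in> sets N" "B \<in> sets L" by auto
    have "prob ((X -` A \<inter> space M) \<inter> (Y -` B \<inter> space M)) = prob (X -` A \<inter> space M) * prob (Y -` B \<inter> space M)"
      by (rule indep_setD[OF i]) (auto intro: in_vimage_algebra)
    moreover have "(\<lambda>\<omega>. (X \<omega>, Y \<omega>)) -` (A \<times> B) \<inter> space M = (X -` A \<inter> space M) \<inter> (Y -` B \<inter> space M)"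
      by auto
    ultimately show "emeasure (distr M N X) A * emeasure (distr M L Y) B =
        emeasure (distr M (N \<Otimes>\<^sub>M L) (\<lambda>\<omega>. (X \<omega>, Y \<omega>))) (A \<times> B)"
      by (simp add: emeasure_distr emeasure_eq_measure ennreal_mult)
  qed (auto simp: X.sigma_finite_measure_axioms Y.sigma_finite_measure_axioms)
  then show ?thesis by simp
qed

text \<open>The two hypotheses together make \<open>S\<close>, \<open>W\<close> and \<open>F\<close>
  mutually independent: \<open>S\<close> is split off from the pair, then \<open>W\<close> from
  \<open>F\<close>. Independence of \<open>S + W\<close> from \<open>F\<close> is thus obtained in
  integrated form.\<close>

lemma nn_integral_indep_sum:
  fixes S W :: "'a \<Rightarrow> real" and F :: "'a \<Rightarrow> nat" and h :: "nat \<Rightarrow> ennreal"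
  assumes SWF: "indep_rvs borel S (borel \<Otimes>\<^sub>M count_space UNIV) (\<lambda>\<omega>. (W \<omega>, F \<omega>))"
    and WF: "indep_rvs borel W (count_space UNIV) F"
    and B[measurable]: "B \<in> sets borel"
  shows "(\<integral>\<^sup>+ \<omega>. indicator B (S \<omega> + W \<omega>) * h (F \<omega>) \<partial>M) =
    emeasure M {\<omega> \<in> space M. S \<omega> + W \<omega> \<in> B} * (\<integral>\<^sup>+ \<omega>. h (F \<omega>) \<partial>M)"
proof -
  have [measurable]: "S \<in> borel_measurable M" "W \<in> borel_measurable M" "F \<in> measurable M (count_space UNIV)"
    using SWF WF by (auto simp: indep_rvs_def)
  interpret DS: prob_space "distr M borel S" by (rule prob_space_distr) simp
  interpret DF: prob_space "distr M (count_space UNIV) F" by (rule prob_space_distr) simp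
  interpret DWF: prob_space "distr M (borel \<Otimes>\<^sub>M count_space UNIV) (\<lambda>\<omega>. (W \<omega>, F \<omega>))"
    by (rule prob_space_distr) simp
  interpret DW: prob_space "distr M borel W" by (rule prob_space_distr) simp
  let ?D = "distr M borel W"
  have eq: "(\<integral>\<^sup>+ \<omega>. indicator B (S \<omega> + W \<omega>) * h (F \<omega>) \<partial>M) =
    (\<integral>\<^sup>+ s. \<integral>\<^sup>+ w. indicator B (s + w) \<partial>?D \<partial>distr M borel S) * (\<integral>\<^sup>+ \<omega>. h (F \<omega>) \<partial>M)" for h :: "nat \<Rightarrow> ennreal"
  proof -
    have "(\<integral>\<^sup>+ \<omega>. indicator B (S \<omega> + W \<omega>) * h (F \<omega>) \<partial>M) =
      (\<integral>\<^sup>+ x. (case x of (s, w, f) \<Rightarrow> indicator B (s + w) * h f)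
        \<partial>distr M (borel \<Otimes>\<^sub>M (borel \<Otimes>\<^sub>M count_space UNIV)) (\<lambda>\<omega>. (S \<omega>, W \<omega>, F \<omega>)))"
      by (subst nn_integral_distr) auto
    also have "\<dots> = (\<integral>\<^sup>+ s. \<integral>\<^sup>+ x. (case x of (w, f) \<Rightarrow> indicator B (s + w) * h f)
        \<partial>distr M (borel \<Otimes>\<^sub>M count_space UNIV) (\<lambda>\<omega>. (W \<omega>, F \<omega>)) \<partial>distr M borel S)"
      unfolding indep_rvs_distr[OF SWF] by (subst DWF.nn_integral_fst[symmetric]) auto
    also have "\<dots> = (\<integral>\<^sup>+ s. (\<integral>\<^sup>+ w. indicator B (s + w) \<partial>?D) * (\<integral>\<^sup>+ \<omega>. h (F \<omega>) \<partial>M) \<partial>distr M borel S)"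
    proof (intro nn_integral_cong)
      fix s
      have "(\<integral>\<^sup>+ x. (case x of (w, f) \<Rightarrow> indicator B (s + w) * h f)
        \<partial>distr M (borel \<Otimes>\<^sub>M count_space UNIV) (\<lambda>\<omega>. (W \<omega>, F \<omega>))) =
        (\<integral>\<^sup>+ w. \<integral>\<^sup>+ f. indicator B (s + w) * h f \<partial>distr M (count_space UNIV) F \<partial>?D)"
        unfolding indep_rvs_distr[OF WF] by (subst DF.nn_integral_fst[symmetric]) auto
      also have "\<dots> = (\<integral>\<^sup>+ w. indicator B (s + w) * (\<integral>\<^sup>+ f. h f \<partial>distr M (count_space UNIV) F) \<partial>?D)"
        by (intro nn_integral_cong nn_integral_cmult) auto
      also have "\<dots> = (\<integral>\<^sup>+ w. indicator B (s + w) \<partial>?D) * (\<integral>\<^sup>+ f. h f \<partial>distr M (count_space UNIV) F)"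
        by (intro nn_integral_multc) auto
      also have "(\<integral>\<^sup>+ f. h f \<partial>distr M (count_space UNIV) F) = (\<integral>\<^sup>+ \<omega>. h (F \<omega>) \<partial>M)"
        by (intro nn_integral_distr) auto
      finally show "(\<integral>\<^sup>+ x. (case x of (w, f) \<Rightarrow> indicator B (s + w) * h f)
        \<partial>distr M (borel \<Otimes>\<^sub>M count_space UNIV) (\<lambda>\<omega>. (W \<omega>, F \<omega>))) =
        (\<integral>\<^sup>+ w. indicator B (s + w) \<partial>?D) * (\<integral>\<^sup>+ \<omega>. h (F \<omega>) \<partial>M)" .
    qed
    also have "\<dots> = (\<integral>\<^sup>+ s. \<integral>\<^sup>+ w. indicator B (s + w) \<partial>?D \<partial>distr M borel S) * (\<integral>\<^sup>+ \<omega>. h (F \<omega>) \<partial>M)"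
      by (intro nn_integral_multc) auto
    finally show ?thesis .
  qed
  \<comment> \<open>The choice \<open>h = 1\<close> in \<open>eq\<close> identifies the double
    integral over \<open>S\<close> and \<open>W\<close> as the probability that \<open>S + W\<close>
    lies in \<open>B\<close>.\<close>
  have "emeasure M {\<omega> \<in> space M. S \<omega> + W \<omega> \<in> B} =
     (\<integral>\<^sup>+ \<omega>. indicator {\<omega> \<in> space M. S \<omega> + W \<omega> \<in> B} \<omega> \<partial>M)"
    by (intro nn_integral_indicator[symmetric]) auto
  also have "\<dots> = (\<integral>\<^sup>+ \<omega>. indicator B (S \<omega> + W \<omega>) * 1 \<partial>M)"
    by (intro nn_integral_cong) (auto simp: indicator_def)
  also have "\<dots> = (\<integral>\<^sup>+ s. \<integral>\<^sup>+ w. indicator B (s + w) \<partial>?D \<partial>distr M borel S)"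
    by (subst eq) (simp add: emeasure_space_1)
  finally show ?thesis by (subst eq) simp
qed

text \<open>Only the independence of \<open>T\<close> from each single \<open>F u\<close> is needed: \<open>T\<close> is approximated from the
  right by \<open>(\<lfloor>n T\<rfloor> + 1) / n\<close>, which takes countably many values.\<close>
lemma expectation_at_independent_time:
  fixes F :: "real \<Rightarrow> 'a \<Rightarrow> nat" and T :: "'a \<Rightarrow> real"
  assumes F: "\<And>u. 0 \<le> u \<Longrightarrow> F u \<in> measurable M (count_space UNIV)"
    and mono: "\<And>\<omega> u v. \<omega> \<in> space M \<Longrightarrow> 0 \<le> u \<Longrightarrow> u \<le> v \<Longrightarrow> F u \<omega> \<le> F v \<omega>"
    and right: "\<And>\<omega> u. \<omega> \<in> space M \<Longrightarrow> 0 \<le> u \<Longrightarrow> continuous (at_right u) (\<lambda>v. real (F v \<omega>))"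
    and T[measurable]: "T \<in> borel_measurable M" and T_nonneg: "\<And>\<omega>. \<omega> \<in> space M \<Longrightarrow> 0 \<le> T \<omega>"
    and T_int: "integrable M T" and \<nu>: "0 \<le> \<nu>"
    and indep: "\<And>u B. 0 \<le> u \<Longrightarrow> B \<in> sets borel \<Longrightarrow>
      (\<integral>\<^sup>+ \<omega>. indicator B (T \<omega>) * ennreal (real (F u \<omega>)) \<partial>M) =
      emeasure M {\<omega> \<in> space M. T \<omega> \<in> B} * ennreal (\<nu> * u)"
  shows "has_bochner_integral M (\<lambda>\<omega>. real (F (T \<omega>) \<omega>)) (\<nu> * expectation T)"
proof -
  \<comment> \<open>At a time with countably many values the expectation is a sum over the cells of
    \<open>T\<close>, and \<open>indep\<close> applies to each cell. The sample points
    \<open>g\<close> are left free because they are chosen in two ways below.\<close>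
  have discrete: "(\<lambda>\<omega>. real (F (g (nat \<lfloor>a * T \<omega>\<rfloor>)) \<omega>)) \<in> borel_measurable M"
    "(\<integral>\<^sup>+ \<omega>. ennreal (real (F (g (nat \<lfloor>a * T \<omega>\<rfloor>)) \<omega>)) \<partial>M) =
      (\<integral>\<^sup>+ \<omega>. ennreal (\<nu> * g (nat \<lfloor>a * T \<omega>\<rfloor>)) \<partial>M)"
    if g: "\<And>k. 0 \<le> g k" for g :: "nat \<Rightarrow> real" and a
  proof -
    define K where "K \<omega> = nat \<lfloor>a * T \<omega>\<rfloor>" for \<omega>
    have [measurable]: "K \<in> measurable M (count_space UNIV)" unfolding K_def by measurable
    have Fg[measurable]: "F (g k) \<in> measurable M (count_space UNIV)" for k using F g by auto
    have "(\<lambda>\<omega>. F (g (K \<omega>)) \<omega>) \<in> measurable M (count_space UNIV)"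
      by (rule measurable_compose_countable[where g = K and f = "\<lambda>k. F (g k)"]) auto
    then show "(\<lambda>\<omega>. real (F (g (nat \<lfloor>a * T \<omega>\<rfloor>)) \<omega>)) \<in> borel_measurable M"
      unfolding K_def by measurable
    define B where "B k = {x::real. nat \<lfloor>a * x\<rfloor> = k}" for k
    have [measurable]: "B k \<in> sets borel" for k unfolding B_def by measurable
    have split: "(\<Sum>k. indicator (B k) (T \<omega>) * f k) = f (K \<omega>)" for f :: "nat \<Rightarrow> ennreal" and \<omega>
    proof -
      have "(\<lambda>k. indicator (B k) (T \<omega>) * f k) = (\<lambda>k. if k = K \<omega> then f k else 0)"
        by (auto simp: B_def K_def indicator_def)
      then show ?thesis using sums_single[of "K \<omega>" f] by (simp add: sums_iff)
    qed
    have "(\<integral>\<^sup>+ \<omega>. ennreal (real (F (g (K \<omega>)) \<omega>)) \<partial>M) =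
        (\<integral>\<^sup>+ \<omega>. (\<Sum>k. indicator (B k) (T \<omega>) * ennreal (real (F (g k) \<omega>))) \<partial>M)"
      by (intro nn_integral_cong) (simp add: split)
    also have "\<dots> = (\<Sum>k. \<integral>\<^sup>+ \<omega>. indicator (B k) (T \<omega>) * ennreal (real (F (g k) \<omega>)) \<partial>M)"
      by (intro nn_integral_suminf) measurable
    also have "\<dots> = (\<Sum>k. \<integral>\<^sup>+ \<omega>. indicator (B k) (T \<omega>) * ennreal (\<nu> * g k) \<partial>M)"
    proof (intro suminf_cong)
      fix k
      have "(\<integral>\<^sup>+ \<omega>. indicator (B k) (T \<omega>) * ennreal (\<nu> * g k) \<partial>M) =
        (\<integral>\<^sup>+ \<omega>. ennreal (\<nu> * g k) * indicator {\<omega> \<in> space M. T \<omega> \<in> B k} \<omega> \<partial>M)"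
        by (intro nn_integral_cong) (auto simp: indicator_def)
      also have "\<dots> = ennreal (\<nu> * g k) * emeasure M {\<omega> \<in> space M. T \<omega> \<in> B k}"
        by (intro nn_integral_cmult_indicator) measurable
      finally show "(\<integral>\<^sup>+ \<omega>. indicator (B k) (T \<omega>) * ennreal (real (F (g k) \<omega>)) \<partial>M) =
        (\<integral>\<^sup>+ \<omega>. indicator (B k) (T \<omega>) * ennreal (\<nu> * g k) \<partial>M)"
        by (simp add: indep g mult.commute)
    qed
    also have "\<dots> = (\<integral>\<^sup>+ \<omega>. (\<Sum>k. indicator (B k) (T \<omega>) * ennreal (\<nu> * g k)) \<partial>M)"
      by (intro nn_integral_suminf[symmetric]) measurable
    also have "\<dots> = (\<integral>\<^sup>+ \<omega>. ennreal (\<nu> * g (K \<omega>)) \<partial>M)"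
      by (intro nn_integral_cong) (simp add: split)
    finally show "(\<integral>\<^sup>+ \<omega>. ennreal (real (F (g (nat \<lfloor>a * T \<omega>\<rfloor>)) \<omega>)) \<partial>M) =
      (\<integral>\<^sup>+ \<omega>. ennreal (\<nu> * g (nat \<lfloor>a * T \<omega>\<rfloor>)) \<partial>M)" unfolding K_def .
  qed
  have bochner: "has_bochner_integral M (\<lambda>\<omega>. real (F (g (nat \<lfloor>a * T \<omega>\<rfloor>)) \<omega>))
      (expectation (\<lambda>\<omega>. \<nu> * g (nat \<lfloor>a * T \<omega>\<rfloor>)))"
    if g: "\<And>k. 0 \<le> g k" and le: "\<And>\<omega>. \<omega> \<in> space M \<Longrightarrow> g (nat \<lfloor>a * T \<omega>\<rfloor>) \<le> T \<omega> + 2"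
    for g :: "nat \<Rightarrow> real" and a
  proof -
    have "integrable M (\<lambda>\<omega>. \<nu> * g (nat \<lfloor>a * T \<omega>\<rfloor>))"
    proof (intro integrable_mult_right Bochner_Integration.integrable_bound[where g = "\<lambda>\<omega>. g (nat \<lfloor>a * T \<omega>\<rfloor>)" and f = "\<lambda>\<omega>. T \<omega> + 2"])
      show "(\<lambda>\<omega>. g (nat \<lfloor>a * T \<omega>\<rfloor>)) \<in> borel_measurable M" by measurable
      show "AE \<omega> in M. norm (g (nat \<lfloor>a * T \<omega>\<rfloor>)) \<le> norm (T \<omega> + 2)"
        using AE_space by eventually_elim (use g le T_nonneg in fastforce)
    qed (use T_int in auto)
    then have "(\<integral>\<^sup>+ \<omega>. ennreal (\<nu> * g (nat \<lfloor>a * T \<omega>\<rfloor>)) \<partial>M) = ennreal (expectation (\<lambda>\<omega>. \<nu> * g (nat \<lfloor>a * T \<omega>\<rfloor>)))"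
      using \<nu> g by (intro nn_integral_eq_integral) auto
    then show ?thesis
      using discrete(1)[of g a, OF g] discrete(2)[of g a, OF g] \<nu> g by (intro has_bochner_integral_nn_integral) (auto intro!: integral_nonneg)
  qed
  \<comment> \<open>The numerator \<open>k + 1\<close> makes \<open>Tn n\<close> strictly larger
    than \<open>T\<close>, as needed to use right-continuity of the paths.\<close>
  define \<tau> where "\<tau> n k = (real k + 1) / real (Suc n)" for n k :: nat
  define Tn where "Tn n \<omega> = \<tau> n (nat \<lfloor>real (Suc n) * T \<omega>\<rfloor>)" for n \<omega>
  have \<tau>_nonneg: "0 \<le> \<tau> n k" for n k by (simp add: \<tau>_def)
  have Tn: "T \<omega> < Tn n \<omega>" "Tn n \<omega> \<le> T \<omega> + 1 / real (Suc n)" if "\<omega> \<in> space M" for n \<omega>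
  proof -
    have "real (nat \<lfloor>real (Suc n) * T \<omega>\<rfloor>) = of_int \<lfloor>real (Suc n) * T \<omega>\<rfloor>"
      using T_nonneg[OF that] by simp
    then show "T \<omega> < Tn n \<omega>" "Tn n \<omega> \<le> T \<omega> + 1 / real (Suc n)"
      unfolding Tn_def \<tau>_def by (simp_all add: field_simps del: of_nat_Suc) linarith+
  qed
  have Tn_lim: "(\<lambda>n. Tn n \<omega>) \<longlonglongrightarrow> T \<omega>" if "\<omega> \<in> space M" for \<omega>
  proof (rule tendsto_sandwich[where f = "\<lambda>_. T \<omega>" and h = "\<lambda>n. T \<omega> + 1 / real (Suc n)"])
    show "(\<lambda>n. T \<omega> + 1 / real (Suc n)) \<longlonglongrightarrow> T \<omega>"
      using tendsto_add[OF tendsto_const LIMSEQ_Suc[OF lim_1_over_n]] by simp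
  qed (use Tn[OF that] in \<open>auto intro!: always_eventually less_imp_le simp del: of_nat_Suc\<close>)
  have Tn_le: "Tn n \<omega> \<le> T \<omega> + 1" if "\<omega> \<in> space M" for n \<omega>
  proof -
    have "1 / real (Suc n) \<le> 1" by simp
    with Tn(2)[OF that, of n] show ?thesis by linarith
  qed
  \<comment> \<open>The dominating variable must itself be sampled at a discrete time, so that
    \<open>bochner\<close> yields its integrability. The shift by 2 suffices because
    \<open>Tn n\<close> is at most \<open>T + 1\<close>, which is below
    \<open>\<lfloor>T\<rfloor> + 2\<close>.\<close>
  define w where "w \<omega> = real (F (real (nat \<lfloor>1 * T \<omega>\<rfloor>) + 2) \<omega>)" for \<omega>
  have w: "integrable M w"
  proof -
    have "has_bochner_integral M (\<lambda>\<omega>. real (F (real (nat \<lfloor>1 * T \<omega>\<rfloor>) + 2) \<omega>))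
      (expectation (\<lambda>\<omega>. \<nu> * (real (nat \<lfloor>1 * T \<omega>\<rfloor>) + 2)))"
      using bochner[of "\<lambda>k. real k + 2" 1] T_nonneg by force
    then show ?thesis unfolding w_def has_bochner_integral_iff by blast
  qed
  have FTn: "has_bochner_integral M (\<lambda>\<omega>. real (F (Tn n \<omega>) \<omega>)) (expectation (\<lambda>\<omega>. \<nu> * Tn n \<omega>))" for n
    unfolding Tn_def using Tn_le[unfolded Tn_def, of _ n]
    by (intro bochner \<tau>_nonneg) fastforce
  have FTn_lim: "(\<lambda>n. real (F (Tn n \<omega>) \<omega>)) \<longlonglongrightarrow> real (F (T \<omega>) \<omega>)" if "\<omega> \<in> space M" for \<omega>
  proof -
    have "filterlim (\<lambda>n. Tn n \<omega>) (at_right (T \<omega>)) sequentially"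
      unfolding filterlim_at using Tn(1)[OF that] Tn_lim[OF that]
      by (auto intro!: always_eventually simp: less_imp_neq[THEN not_sym])
    with right[OF that T_nonneg[OF that]] show ?thesis
      unfolding continuous_within by (rule filterlim_compose)
  qed
  have meas: "(\<lambda>\<omega>. real (F (T \<omega>) \<omega>)) \<in> borel_measurable M"
    by (rule borel_measurable_LIMSEQ_real[OF FTn_lim]) (use FTn in \<open>auto simp: has_bochner_integral_iff\<close>)
  have bound: "AE \<omega> in M. norm (real (F (Tn n \<omega>) \<omega>)) \<le> w \<omega>" for n
    using AE_space
  proof eventually_elim
    case (elim \<omega>)
    have "Tn n \<omega> \<le> real (nat \<lfloor>1 * T \<omega>\<rfloor>) + 2"
      using Tn_le[OF elim, of n] T_nonneg[OF elim] by linarith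
    with mono[OF elim _ this] show ?case
      using Tn(1)[OF elim, of n] T_nonneg[OF elim] by (simp add: w_def)
  qed
  have dc: "integrable M (\<lambda>\<omega>. real (F (T \<omega>) \<omega>))"
    "(\<lambda>n. expectation (\<lambda>\<omega>. real (F (Tn n \<omega>) \<omega>))) \<longlonglongrightarrow> expectation (\<lambda>\<omega>. real (F (T \<omega>) \<omega>))"
  proof -
    have lim: "AE \<omega> in M. (\<lambda>n. real (F (Tn n \<omega>) \<omega>)) \<longlonglongrightarrow> real (F (T \<omega>) \<omega>)"
      using AE_space by eventually_elim (rule FTn_lim)
    have FTn_meas: "(\<lambda>\<omega>. real (F (Tn n \<omega>) \<omega>)) \<in> borel_measurable M" for n
      using FTn[of n] by (auto simp: has_bochner_integral_iff)
    show "integrable M (\<lambda>\<omega>. real (F (T \<omega>) \<omega>))"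
      by (rule integrable_dominated_convergence[OF meas FTn_meas w lim bound])
    show "(\<lambda>n. expectation (\<lambda>\<omega>. real (F (Tn n \<omega>) \<omega>))) \<longlonglongrightarrow> expectation (\<lambda>\<omega>. real (F (T \<omega>) \<omega>))"
      by (rule integral_dominated_convergence[OF meas FTn_meas w lim bound])
  qed
  have "(\<lambda>n. expectation (\<lambda>\<omega>. \<nu> * Tn n \<omega>)) \<longlonglongrightarrow> expectation (\<lambda>\<omega>. \<nu> * T \<omega>)"
  proof (rule integral_dominated_convergence[where w = "\<lambda>\<omega>. \<nu> * (T \<omega> + 1)"])
    show "AE \<omega> in M. (\<lambda>n. \<nu> * Tn n \<omega>) \<longlonglongrightarrow> \<nu> * T \<omega>"
      using AE_space by eventually_elim (auto intro!: tendsto_intros Tn_lim)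
    show "AE \<omega> in M. norm (\<nu> * Tn n \<omega>) \<le> \<nu> * (T \<omega> + 1)" for n
      using AE_space
      by eventually_elim (use \<nu> Tn_le \<tau>_nonneg in \<open>auto simp: abs_mult Tn_def intro!: mult_left_mono\<close>)
    show "(\<lambda>\<omega>. \<nu> * Tn n \<omega>) \<in> borel_measurable M" for n
      unfolding Tn_def \<tau>_def by measurable
  qed (use T_int in auto)
  moreover have "expectation (\<lambda>\<omega>. real (F (Tn n \<omega>) \<omega>)) = expectation (\<lambda>\<omega>. \<nu> * Tn n \<omega>)" for n
    using FTn by (simp add: has_bochner_integral_iff)
  ultimately have "expectation (\<lambda>\<omega>. real (F (T \<omega>) \<omega>)) = expectation (\<lambda>\<omega>. \<nu> * T \<omega>)"
    using LIMSEQ_unique[OF dc(2)] by auto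
  with dc(1) show ?thesis by (simp add: has_bochner_integral_iff)
qed

end

section \<open>Virtual waiting times\<close>

lemma nn_integral_exponential:
  assumes "0 < l"
  shows "(\<integral>\<^sup>+ x. ennreal x \<partial>density lborel (exponential_density l)) = ennreal (1 / l)"
proof -
  have "(\<integral>\<^sup>+ x. ennreal x \<partial>density lborel (exponential_density l)) =
      (\<integral>\<^sup>+ x. ennreal (exponential_density l x * x ^ 1) \<partial>lborel)"
    using assms by (subst nn_integral_density) (auto simp: ennreal_mult'' ennreal_mult' exponential_density_nonneg)
  also have "\<dots> = ennreal (1 / l)"
    using nn_integral_erlang_ith_moment[OF assms, of 0 1] by simp
  finally show ?thesis .
qed

definition mean_virtual_wait :: "real \<Rightarrow> real \<Rightarrow> real \<Rightarrow> nat \<Rightarrow> real" where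
  "mean_virtual_wait \<mu> \<theta> s n =
     (if real n < s then 0 else \<Sum>j\<in>{0..nat \<lfloor>real n - s\<rfloor>}. 1 / (\<mu> * s + \<theta> * real j))"

lemma nn_integral_virtual_wait_law:
  assumes pos: "0 < \<mu>" "0 < \<theta>" "0 < s"
  shows "(\<integral>\<^sup>+ x. ennreal x \<partial>virtual_wait_law \<mu> \<theta> s n) = ennreal (mean_virtual_wait \<mu> \<theta> s n)"
proof (cases "real n < s")
  case True
  then show ?thesis by (simp add: virtual_wait_law_def mean_virtual_wait_def nn_integral_return)
next
  case False
  define J where "J = {0..nat \<lfloor>real n - s\<rfloor>}"
  define l where "l j = \<mu> * s + \<theta> * real j" for j
  define E where "E j = density lborel (exponential_density (l j))" for j
  have l: "0 < l j" for j using pos by (simp add: l_def add_pos_nonneg)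
  have prob: "prob_space (E j)" for j unfolding E_def by (rule prob_space_exponential_density[OF l])
  have [simp]: "sets (E j) = sets borel" for j by (simp add: E_def)
  have fin: "finite J" by (simp add: J_def)
  have [measurable]: "(\<lambda>y. y j) \<in> borel_measurable (Pi\<^sub>M J E)" if "j \<in> J" for j
    using measurable_component_singleton[OF that, of E] by (simp cong: measurable_cong_sets)
  \<comment> \<open>\<open>ennreal\<close> sends negative numbers to 0, so it commutes with the sum
    only where all coordinates are nonnegative; the exponential densities vanish on the negative
    axis.\<close>
  have "AE y in Pi\<^sub>M J E. 0 \<le> y j" if "j \<in> J" for j
  proof (rule AE_PiM_component[OF prob that])
    show "AE x in E j. 0 \<le> x"
      unfolding E_def by (subst AE_density) (auto simp: exponential_density_def)
  qed
  then have nonneg: "AE y in Pi\<^sub>M J E. \<forall>j\<in>J. 0 \<le> y j"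
    by (intro AE_finite_allI[OF fin]) auto
  have comp: "(\<integral>\<^sup>+ y. ennreal (y j) \<partial>Pi\<^sub>M J E) = ennreal (1 / l j)" if "j \<in> J" for j
  proof -
    have "ennreal (1 / l j) = (\<integral>\<^sup>+ x. ennreal x \<partial>distr (Pi\<^sub>M J E) (E j) (\<lambda>y. y j))"
      by (subst distr_PiM_component[where M = E, OF prob that]) (simp add: E_def nn_integral_exponential[OF l])
    also have "\<dots> = (\<integral>\<^sup>+ y. ennreal (y j) \<partial>Pi\<^sub>M J E)"
      by (intro nn_integral_distr measurable_component_singleton that) (simp cong: measurable_cong_sets)
    finally show ?thesis by simp
  qed
  have "(\<integral>\<^sup>+ x. ennreal x \<partial>virtual_wait_law \<mu> \<theta> s n) = (\<integral>\<^sup>+ y. ennreal (\<Sum>j\<in>J. y j) \<partial>Pi\<^sub>M J E)"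
    using False by (simp add: virtual_wait_law_def Let_def J_def[symmetric] l_def[symmetric] E_def[symmetric] nn_integral_distr)
  also have "\<dots> = (\<integral>\<^sup>+ y. (\<Sum>j\<in>J. ennreal (y j)) \<partial>Pi\<^sub>M J E)"
    using nonneg by (intro nn_integral_cong_AE) (auto elim!: eventually_mono)
  also have "\<dots> = (\<Sum>j\<in>J. ennreal (1 / l j))"
    by (subst nn_integral_sum) (auto simp: comp)
  also have "\<dots> = ennreal (\<Sum>j\<in>J. 1 / l j)"
    using l by (intro sum_ennreal) (auto intro: less_imp_le)
  finally show ?thesis
    using False by (simp add: mean_virtual_wait_def J_def l_def)
qed

section \<open>Harmonic sums and the logarithm\<close>

text \<open>An integral comparison for the decreasing function
  \<open>1 / (a + \<theta> * x)\<close>. It is done without integrals: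
  \<open>ln r \<le> r - 1\<close>, applied to the ratio \<open>r\<close> of neighbouring
  denominators and to its inverse, gives the two one-step bounds.\<close>

lemma sum_inverse_affine_bounds:
  fixes a \<theta> y :: real
  assumes a: "0 < a" and \<theta>: "0 < \<theta>" and y: "0 \<le> y"
  shows "ln (1 + \<theta> * y / a) / \<theta> \<le> (\<Sum>j\<in>{0..nat \<lfloor>y\<rfloor>}. 1 / (a + \<theta> * real j))"
    and "(\<Sum>j\<in>{0..nat \<lfloor>y\<rfloor>}. 1 / (a + \<theta> * real j)) \<le> 1 / a + ln (1 + \<theta> * y / a) / \<theta>"
proof -
  \<comment> \<open>The antiderivative of \<open>1 / (a + \<theta> * x)\<close> that vanishes at
    0.\<close>
  define G where "G x = ln (1 + \<theta> * x / a) / \<theta>" for x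
  have pos: "0 < a + \<theta> * real j" for j using a \<theta> by (simp add: add_pos_nonneg)
  have G_mono: "G u \<le> G v" if "0 \<le> u" "u \<le> v" for u v
    unfolding G_def using a \<theta> that
    by (intro divide_right_mono ln_mono add_left_mono mult_left_mono) (auto simp: add_pos_nonneg)
  have step: "1 / (a + \<theta> * real (Suc j)) \<le> G (real (Suc j)) - G (real j)"
    "G (real (Suc j)) - G (real j) \<le> 1 / (a + \<theta> * real j)" for j
  proof -
    define r where "r = (a + \<theta> * real (Suc j)) / (a + \<theta> * real j)"
    have r: "r > 0" using pos[of j] pos[of "Suc j"] by (simp add: r_def del: of_nat_Suc)
    have "G (real (Suc j)) - G (real j) = (ln (1 + \<theta> * real (Suc j) / a) - ln (1 + \<theta> * real j / a)) / \<theta>"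
      by (simp add: G_def diff_divide_distrib)
    also have "ln (1 + \<theta> * real (Suc j) / a) - ln (1 + \<theta> * real j / a) =
        ln ((1 + \<theta> * real (Suc j) / a) / (1 + \<theta> * real j / a))"
    proof -
      have "0 < 1 + \<theta> * real i / a" for i using a \<theta> by (simp add: add_pos_nonneg)
      from this[of "Suc j"] this[of j] show ?thesis by (subst ln_div) simp_all
    qed
    also have "(1 + \<theta> * real (Suc j) / a) / (1 + \<theta> * real j / a) = r"
    proof -
      have "1 + \<theta> * x / a = (a + \<theta> * x) / a" for x using a by (simp add: add_divide_distrib)
      then show ?thesis using a by (simp add: r_def)
    qed
    finally have G: "G (real (Suc j)) - G (real j) = ln r / \<theta>" .
    have "ln r \<le> r - 1" using r by (rule ln_le_minus_one)
    also have "r - 1 = \<theta> * (1 / (a + \<theta> * real j))"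
      using pos[of j] by (simp add: r_def field_simps)
    finally show "G (real (Suc j)) - G (real j) \<le> 1 / (a + \<theta> * real j)"
      using \<theta> unfolding G by (subst pos_divide_le_eq) (auto simp: mult.commute)
    have "ln (inverse r) \<le> inverse r - 1" using r by (intro ln_le_minus_one) simp
    moreover have "1 - inverse r = \<theta> * (1 / (a + \<theta> * real (Suc j)))"
      using pos[of "Suc j"] by (simp add: r_def field_simps)
    ultimately have "\<theta> * (1 / (a + \<theta> * real (Suc j))) \<le> ln r"
      using r by (simp add: ln_inverse)
    then show "1 / (a + \<theta> * real (Suc j)) \<le> G (real (Suc j)) - G (real j)"
      using \<theta> unfolding G by (subst pos_le_divide_eq) (auto simp: mult.commute)
  qed
  \<comment> \<open>The lower bound telescopes to \<open>Suc k\<close>, the upper one only to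
    \<open>k\<close> at the price of the first summand \<open>1 / a\<close>. Since \<open>y\<close>
    lies between \<open>k\<close> and \<open>Suc k\<close>, monotonicity of \<open>G\<close>
    finishes both.\<close>
  have sums: "G (real (Suc k)) \<le> (\<Sum>j\<in>{0..k}. 1 / (a + \<theta> * real j))"
    "(\<Sum>j\<in>{0..k}. 1 / (a + \<theta> * real j)) \<le> 1 / a + G (real k)" for k
  proof (induction k)
    case 0
    { case 1 show ?case using step(2)[of 0] by (simp add: G_def) next
      case 2 show ?case by (simp add: G_def) }
  next
    case (Suc k)
    { case 1 show ?case using step(2)[of "Suc k"] Suc(1) by simp next
      case 2 show ?case using step(1)[of k] Suc(2) by simp }
  qed
  define k where "k = nat \<lfloor>y\<rfloor>"
  have k: "real k \<le> y" "y \<le> real (Suc k)" using y by (auto simp: k_def) linarith+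
  show "ln (1 + \<theta> * y / a) / \<theta> \<le> (\<Sum>j\<in>{0..nat \<lfloor>y\<rfloor>}. 1 / (a + \<theta> * real j))"
    using sums(1)[of k] G_mono[of y "real (Suc k)"] k y by (simp add: G_def k_def)
  show "(\<Sum>j\<in>{0..nat \<lfloor>y\<rfloor>}. 1 / (a + \<theta> * real j)) \<le> 1 / a + ln (1 + \<theta> * y / a) / \<theta>"
    using sums(2)[of k] G_mono[of "real k" y] k y by (simp add: G_def k_def)
qed

text \<open>The integral of \<open>1 / (\<mu> * c + \<theta> * y)\<close> over \<open>y\<close> from
  0 to \<open>max (x - c) 0\<close>: the time in which a fluid queue without arrivals, served at
  rate \<open>\<mu> * c\<close> and abandoned at rate \<open>\<theta>\<close> per unit waiting,
  empties.\<close>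

definition fluid_wait :: "real \<Rightarrow> real \<Rightarrow> real \<Rightarrow> real \<Rightarrow> real" where
  "fluid_wait \<mu> \<theta> c x = ln (1 + \<theta> * max (x - c) 0 / (\<mu> * c)) / \<theta>"

lemma fluid_wait_nonneg: "0 < \<mu> \<Longrightarrow> 0 < \<theta> \<Longrightarrow> 0 < c \<Longrightarrow> 0 \<le> fluid_wait \<mu> \<theta> c x"
  by (simp add: fluid_wait_def)

text \<open>The scale \<open>\<eta>\<close> cancels inside the logarithm. The remaining error does
  not depend on \<open>n\<close>, so it survives taking expectations over the queue length.\<close>

lemma mean_virtual_wait_bounds:
  assumes pos: "0 < \<mu>" "0 < \<theta>" "0 < c" "0 < \<eta>"
  shows "fluid_wait \<mu> \<theta> c (real n / \<eta>) \<le> mean_virtual_wait \<mu> \<theta> (\<eta> * c) n"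
    and "mean_virtual_wait \<mu> \<theta> (\<eta> * c) n \<le> 1 / (\<mu> * (\<eta> * c)) + fluid_wait \<mu> \<theta> c (real n / \<eta>)"
proof -
  have "fluid_wait \<mu> \<theta> c (real n / \<eta>) \<le> mean_virtual_wait \<mu> \<theta> (\<eta> * c) n \<and>
    mean_virtual_wait \<mu> \<theta> (\<eta> * c) n \<le> 1 / (\<mu> * (\<eta> * c)) + fluid_wait \<mu> \<theta> c (real n / \<eta>)"
  proof (cases "real n < \<eta> * c")
    case True
    then have "max (real n / \<eta> - c) 0 = 0" using pos by (simp add: field_simps max_def)
    then show ?thesis using True pos by (simp add: mean_virtual_wait_def fluid_wait_def)
  next
    case False
    then have "max (real n / \<eta> - c) 0 = real n / \<eta> - c" using pos by (simp add: field_simps max_def)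
    moreover have "\<theta> * (real n / \<eta> - c) / (\<mu> * c) = \<theta> * (real n - \<eta> * c) / (\<mu> * (\<eta> * c))"
      using pos by (simp add: field_simps)
    ultimately show ?thesis
      using sum_inverse_affine_bounds[of "\<mu> * (\<eta> * c)" \<theta> "real n - \<eta> * c"] False pos
      by (simp add: mean_virtual_wait_def fluid_wait_def)
  qed
  then show "fluid_wait \<mu> \<theta> c (real n / \<eta>) \<le> mean_virtual_wait \<mu> \<theta> (\<eta> * c) n"
    "mean_virtual_wait \<mu> \<theta> (\<eta> * c) n \<le> 1 / (\<mu> * (\<eta> * c)) + fluid_wait \<mu> \<theta> c (real n / \<eta>)" by auto
qed

text \<open>The slope is largest where nobody waits, and there it is \<open>1 / (\<mu> * c)\<close>.
  Comparing \<open>ln V - ln U\<close> with \<open>V / U - 1\<close>, where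
  \<open>U \<ge> 1\<close>, avoids differentiating across the kink at \<open>c\<close>.\<close>

lemma fluid_wait_lipschitz:
  assumes pos: "0 < \<mu>" "0 < \<theta>" "0 < c"
  shows "\<bar>fluid_wait \<mu> \<theta> c x - fluid_wait \<mu> \<theta> c y\<bar> \<le> \<bar>x - y\<bar> / (\<mu> * c)"
proof -
  have one: "fluid_wait \<mu> \<theta> c v - fluid_wait \<mu> \<theta> c u \<le> \<bar>v - u\<bar> / (\<mu> * c)" for u v
  proof -
    define U where "U = 1 + \<theta> * max (u - c) 0 / (\<mu> * c)"
    define V where "V = 1 + \<theta> * max (v - c) 0 / (\<mu> * c)"
    have UV: "1 \<le> U" "1 \<le> V" using pos by (auto simp: U_def V_def)
    have "ln V - ln U = ln (V / U)" using UV by (subst ln_div) auto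
    also have "\<dots> \<le> V / U - 1" using UV by (intro ln_le_minus_one) auto
    also have "\<dots> = (V - U) / U" using UV by (simp add: diff_divide_distrib)
    also have "\<dots> \<le> \<bar>V - U\<bar> / 1" using UV by (intro frac_le) auto
    also have "V - U = \<theta> * ((max (v - c) 0 - max (u - c) 0) / (\<mu> * c))"
      using pos by (simp add: U_def V_def field_simps)
    also have "\<bar>\<dots>\<bar> / 1 \<le> \<theta> * (\<bar>v - u\<bar> / (\<mu> * c))"
      using pos by (auto simp: abs_mult intro!: divide_right_mono)
    finally have "ln V - ln U \<le> \<theta> * (\<bar>v - u\<bar> / (\<mu> * c))" .
    then show ?thesis using pos by (simp add: fluid_wait_def U_def V_def field_simps)
  qed
  show ?thesis using one[of x y] one[of y x] by (simp add: abs_minus_commute abs_le_iff)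
qed

lemma prob_space_virtual_wait_law:
  assumes "0 < \<mu>" "0 < \<theta>" "0 < s"
  shows "prob_space (virtual_wait_law \<mu> \<theta> s n)"
proof (cases "real n < s")
  case True
  then show ?thesis by (simp add: virtual_wait_law_def prob_space_return)
next
  case False
  let ?E = "\<lambda>j. density lborel (exponential_density (\<mu> * s + \<theta> * real j))"
  have "prob_space (?E j)" for j
    using assms by (intro prob_space_exponential_density) (simp add: add_pos_nonneg)
  then have "prob_space (Pi\<^sub>M {0..nat \<lfloor>real n - s\<rfloor>} ?E)" by (intro prob_space_PiM)
  moreover have "(\<lambda>y. \<Sum>j\<in>{0..nat \<lfloor>real n - s\<rfloor>}. y j) \<in> borel_measurable (Pi\<^sub>M {0..nat \<lfloor>real n - s\<rfloor>} ?E)"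
    by (intro borel_measurable_sum) (use measurable_component_singleton[of _ _ ?E] in \<open>simp cong: measurable_cong_sets\<close>)
  ultimately show ?thesis
    using False by (simp add: virtual_wait_law_def Let_def prob_space.prob_space_distr)
qed

lemma sets_virtual_wait_law: "sets (virtual_wait_law \<mu> \<theta> s n) = sets borel"
  by (simp add: virtual_wait_law_def Let_def)

section \<open>Convergence in mean\<close>

text \<open>Dominated convergence works along sequences, and the model speaks only of positive
  \<open>\<eta>\<close>. A general sequence is replaced by its maximum with 1, which changes
  finitely many terms.\<close>

lemma tendsto_at_top_positive_sequences:
  fixes f :: "real \<Rightarrow> real"
  assumes "\<And>X. filterlim X at_top sequentially \<Longrightarrow> (\<And>k. 0 < X k) \<Longrightarrow> (\<lambda>k. f (X k)) \<longlonglongrightarrow> y"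
  shows "(f \<longlongrightarrow> y) at_top"
proof (rule tendsto_at_topI_sequentially)
  fix X :: "nat \<Rightarrow> real" assume X: "filterlim X at_top sequentially"
  then have ev: "\<forall>\<^sub>F k in sequentially. 1 \<le> X k" by (simp add: filterlim_at_top)
  have "filterlim (\<lambda>k. max (X k) 1) at_top sequentially"
    by (rule filterlim_at_top_mono[OF X]) auto
  from assms[OF this] have "(\<lambda>k. f (max (X k) 1)) \<longlonglongrightarrow> y" by (simp add: less_max_iff_disj)
  then show "(\<lambda>k. f (X k)) \<longlonglongrightarrow> y"
    by (rule Lim_transform_eventually) (use ev in \<open>auto elim!: eventually_mono simp: max_def\<close>)
qed

context prob_space
begin

text \<open>Pratt's lemma for constant limits: \<open>Y\<close> truncated at \<open>z\<close> is handled by bounded convergence,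
  and the excess of \<open>Y\<close> over \<open>z\<close> by the convergence of the means of \<open>Z\<close>.\<close>
lemma tendsto_L1_dominated:
  fixes Y Z :: "nat \<Rightarrow> 'a \<Rightarrow> real"
  assumes Y[measurable]: "\<And>k. Y k \<in> borel_measurable M" and Z: "\<And>k. integrable M (Z k)"
    and le: "\<And>k. AE \<omega> in M. 0 \<le> Y k \<omega> \<and> Y k \<omega> \<le> Z k \<omega>"
    and Ylim: "AE \<omega> in M. (\<lambda>k. Y k \<omega>) \<longlonglongrightarrow> y"
    and Zlim: "AE \<omega> in M. (\<lambda>k. Z k \<omega>) \<longlonglongrightarrow> z"
    and Zmean: "(\<lambda>k. expectation (Z k)) \<longlonglongrightarrow> z"
  shows "(\<lambda>k. expectation (\<lambda>\<omega>. \<bar>Y k \<omega> - y\<bar>)) \<longlonglongrightarrow> 0"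
proof -
  have [measurable]: "Z k \<in> borel_measurable M" for k using Z by auto
  have Yint: "integrable M (Y k)" for k
  proof (rule Bochner_Integration.integrable_bound[OF Z[of k]])
    show "AE \<omega> in M. norm (Y k \<omega>) \<le> norm (Z k \<omega>)"
      using le[of k] by eventually_elim auto
  qed simp
  have 1: "(\<lambda>k. expectation (\<lambda>\<omega>. \<bar>min (Y k \<omega>) z - y\<bar>)) \<longlonglongrightarrow> expectation (\<lambda>_. \<bar>min y z - y\<bar>)"
  proof (rule integral_dominated_convergence[where w = "\<lambda>_. \<bar>z\<bar> + \<bar>y\<bar>"])
    show "AE \<omega> in M. (\<lambda>k. \<bar>min (Y k \<omega>) z - y\<bar>) \<longlonglongrightarrow> \<bar>min y z - y\<bar>"
      using Ylim by eventually_elim (intro tendsto_intros)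
    show "AE \<omega> in M. norm \<bar>min (Y k \<omega>) z - y\<bar> \<le> \<bar>z\<bar> + \<bar>y\<bar>" for k
      using le[of k] by eventually_elim auto
  qed auto
  \<comment> \<open>Only the negative part of \<open>Z k - z\<close> is bounded, by nonnegativity of
    \<open>Z k\<close>. Once its mean vanishes, the convergence of the means of \<open>Z k\<close>
    forces the positive part to vanish in mean as well.\<close>
  have 2: "(\<lambda>k. expectation (\<lambda>\<omega>. max (z - Z k \<omega>) 0)) \<longlonglongrightarrow> expectation (\<lambda>_. max (z - z) 0)"
  proof (rule integral_dominated_convergence[where w = "\<lambda>_. \<bar>z\<bar>"])
    show "AE \<omega> in M. (\<lambda>k. max (z - Z k \<omega>) 0) \<longlonglongrightarrow> max (z - z) 0"
      using Zlim by eventually_elim (intro tendsto_intros)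
    show "AE \<omega> in M. norm (max (z - Z k \<omega>) 0) \<le> \<bar>z\<bar>" for k
      using le[of k] by eventually_elim auto
  qed auto
  \<comment> \<open>The domination passes to the limits, which are constants; hence truncating at
    \<open>z\<close> leaves \<open>y\<close> unchanged and the limit in \<open>1\<close> is
    0.\<close>
  have yz: "y \<le> z"
  proof -
    have "AE \<omega> in M. \<forall>k. Y k \<omega> \<le> Z k \<omega>"
      using le by (subst AE_all_countable) (auto elim!: eventually_mono)
    then have "AE \<omega> in M. y \<le> z"
      using Ylim Zlim by eventually_elim (auto intro: LIMSEQ_le)
    then show ?thesis by simp
  qed
  let ?R = "\<lambda>k. expectation (\<lambda>\<omega>. \<bar>min (Y k \<omega>) z - y\<bar>) + (expectation (Z k) - z) +
    expectation (\<lambda>\<omega>. max (z - Z k \<omega>) 0)"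
  have "?R \<longlonglongrightarrow> 0 + (z - z) + 0"
    using 1 2 Zmean yz by (intro tendsto_add tendsto_diff tendsto_const) (auto simp: min_absorb1)
  then have R: "?R \<longlonglongrightarrow> 0" by simp
  show "(\<lambda>k. expectation (\<lambda>\<omega>. \<bar>Y k \<omega> - y\<bar>)) \<longlonglongrightarrow> 0"
  proof (rule tendsto_sandwich[OF _ _ tendsto_const R])
    show "\<forall>\<^sub>F k in sequentially. 0 \<le> expectation (\<lambda>\<omega>. \<bar>Y k \<omega> - y\<bar>)"
      by (intro always_eventually allI integral_nonneg) auto
    show "\<forall>\<^sub>F k in sequentially. expectation (\<lambda>\<omega>. \<bar>Y k \<omega> - y\<bar>) \<le> ?R k"
    proof (intro always_eventually allI)
      fix k
      have i: "integrable M (\<lambda>\<omega>. \<bar>min (Y k \<omega>) z - y\<bar>)" "integrable M (\<lambda>\<omega>. max (z - Z k \<omega>) 0)"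
        using Yint Z by auto
      have "expectation (\<lambda>\<omega>. \<bar>Y k \<omega> - y\<bar>) \<le>
          expectation (\<lambda>\<omega>. \<bar>min (Y k \<omega>) z - y\<bar> + (Z k \<omega> - z) + max (z - Z k \<omega>) 0)"
      proof (rule integral_mono_AE)
        \<comment> \<open>The excess of \<open>Y\<close> over \<open>z\<close> is at most the
          positive part of \<open>Z - z\<close>, and a positive part is the number plus its negative
          part.\<close>
        show "AE \<omega> in M. \<bar>Y k \<omega> - y\<bar> \<le> \<bar>min (Y k \<omega>) z - y\<bar> + (Z k \<omega> - z) + max (z - Z k \<omega>) 0"
          using le[of k] by eventually_elim (auto simp: min_def max_def)
      qed (use i Yint Z in auto)
      also have "\<dots> = ?R k" using i Z by (simp add: prob_space)
      finally show "expectation (\<lambda>\<omega>. \<bar>Y k \<omega> - y\<bar>) \<le> ?R k" .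
    qed
  qed
qed

section \<open>Averaging over a conditional law\<close>

lemma nn_integral_conditional_law:
  fixes K :: "'a \<Rightarrow> nat" and W :: "'a \<Rightarrow> real" and L :: "nat \<Rightarrow> real measure"
  assumes K[measurable]: "K \<in> measurable M (count_space UNIV)" and W[measurable]: "W \<in> borel_measurable M"
    and L: "\<And>n. sets (L n) = sets borel" "\<And>n. finite_measure (L n)"
    and law: "\<And>n B. B \<in> sets borel \<Longrightarrow>
      prob {\<omega> \<in> space M. K \<omega> = n \<and> W \<omega> \<in> B} = prob {\<omega> \<in> space M. K \<omega> = n} * measure (L n) B"
  shows "(\<integral>\<^sup>+ \<omega>. ennreal (W \<omega>) \<partial>M) = (\<integral>\<^sup>+ \<omega>. (\<integral>\<^sup>+ x. ennreal x \<partial>L (K \<omega>)) \<partial>M)"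
proof -
  have split: "(\<Sum>n. indicator {\<omega> \<in> space M. K \<omega> = n} \<omega> * f n) = f (K \<omega>)"
    if "\<omega> \<in> space M" for f :: "nat \<Rightarrow> ennreal" and \<omega>
  proof -
    have "(\<lambda>n. indicator {\<omega> \<in> space M. K \<omega> = n} \<omega> * f n) = (\<lambda>n. if n = K \<omega> then f n else 0)"
      using that by (auto simp: indicator_def)
    then show ?thesis using sums_single[of "K \<omega>" f] by (simp add: sums_iff)
  qed
  have each: "(\<integral>\<^sup>+ \<omega>. indicator {\<omega> \<in> space M. K \<omega> = n} \<omega> * ennreal (W \<omega>) \<partial>M) =
    (\<integral>\<^sup>+ \<omega>. indicator {\<omega> \<in> space M. K \<omega> = n} \<omega> * (\<integral>\<^sup>+ x. ennreal x \<partial>L n) \<partial>M)" for n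
  proof -
    let ?A = "{\<omega> \<in> space M. K \<omega> = n}"
    interpret Ln: finite_measure "L n" by (rule L)
    have [measurable_cong]: "sets (L n) = sets borel" by (rule L)
    \<comment> \<open>On the event \<open>K = n\<close>, the unnormalised law of \<open>W\<close> is
      \<open>L n\<close> times the probability of the event. Stating this as an equality of measures
      turns \<open>law\<close>, which concerns sets, into a statement about integrals, also when the
      event has probability 0.\<close>
    have eq: "distr (density M (indicator ?A)) borel W = scale_measure (emeasure M ?A) (L n)"
    proof (rule measure_eqI)
      fix B assume "B \<in> sets (distr (density M (indicator ?A)) borel W)"
      then have [measurable]: "B \<in> sets borel" by simp
      have "emeasure (distr (density M (indicator ?A)) borel W) B =
          (\<integral>\<^sup>+ \<omega>. indicator ?A \<omega> * indicator (W -` B \<inter> space M) \<omega> \<partial>M)"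
        by (subst emeasure_distr) (auto simp: emeasure_density)
      also have "\<dots> = (\<integral>\<^sup>+ \<omega>. indicator {\<omega> \<in> space M. K \<omega> = n \<and> W \<omega> \<in> B} \<omega> \<partial>M)"
        by (intro nn_integral_cong) (auto simp: indicator_def)
      also have "\<dots> = emeasure M {\<omega> \<in> space M. K \<omega> = n \<and> W \<omega> \<in> B}"
        by (intro nn_integral_indicator) measurable
      also have "\<dots> = emeasure M ?A * emeasure (L n) B"
        by (simp add: emeasure_eq_measure Ln.emeasure_eq_measure law ennreal_mult)
      finally show "emeasure (distr (density M (indicator ?A)) borel W) B =
        emeasure (scale_measure (emeasure M ?A) (L n)) B" by simp
    qed (simp add: L)
    have "(\<integral>\<^sup>+ \<omega>. indicator ?A \<omega> * ennreal (W \<omega>) \<partial>M) =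
        (\<integral>\<^sup>+ x. ennreal x \<partial>distr (density M (indicator ?A)) borel W)"
      by (subst nn_integral_distr) (auto simp: nn_integral_density)
    also have "\<dots> = emeasure M ?A * (\<integral>\<^sup>+ x. ennreal x \<partial>L n)"
      unfolding eq by (intro nn_integral_scale_measure) measurable
    also have "\<dots> = (\<integral>\<^sup>+ \<omega>. (\<integral>\<^sup>+ x. ennreal x \<partial>L n) * indicator ?A \<omega> \<partial>M)"
      by (subst nn_integral_cmult_indicator) (auto simp: mult.commute)
    finally show ?thesis by (simp add: mult.commute)
  qed
  have "(\<integral>\<^sup>+ \<omega>. ennreal (W \<omega>) \<partial>M) =
      (\<integral>\<^sup>+ \<omega>. (\<Sum>n. indicator {\<omega> \<in> space M. K \<omega> = n} \<omega> * ennreal (W \<omega>)) \<partial>M)"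
  proof (intro nn_integral_cong)
    fix \<omega> assume "\<omega> \<in> space M"
    from split[OF this, of "\<lambda>_. ennreal (W \<omega>)"]
    show "ennreal (W \<omega>) = (\<Sum>n. indicator {\<omega> \<in> space M. K \<omega> = n} \<omega> * ennreal (W \<omega>))" by simp
  qed
  also have "\<dots> = (\<Sum>n. \<integral>\<^sup>+ \<omega>. indicator {\<omega> \<in> space M. K \<omega> = n} \<omega> * ennreal (W \<omega>) \<partial>M)"
    by (intro nn_integral_suminf) measurable
  also have "\<dots> = (\<Sum>n. \<integral>\<^sup>+ \<omega>. indicator {\<omega> \<in> space M. K \<omega> = n} \<omega> * (\<integral>\<^sup>+ x. ennreal x \<partial>L n) \<partial>M)"
    by (simp add: each)
  also have "\<dots> = (\<integral>\<^sup>+ \<omega>. (\<Sum>n. indicator {\<omega> \<in> space M. K \<omega> = n} \<omega> * (\<integral>\<^sup>+ x. ennreal x \<partial>L n)) \<partial>M)"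
    by (intro nn_integral_suminf[symmetric]) measurable
  also have "\<dots> = (\<integral>\<^sup>+ \<omega>. (\<integral>\<^sup>+ x. ennreal x \<partial>L (K \<omega>)) \<partial>M)"
    by (intro nn_integral_cong) (simp add: split[of _ "\<lambda>n. \<integral>\<^sup>+ x. ennreal x \<partial>L n"])
  finally show ?thesis .
qed

end

section \<open>The fluid equation\<close>

definition erlang_drain :: "real \<Rightarrow> real \<Rightarrow> real \<Rightarrow> real \<Rightarrow> real" where
  "erlang_drain \<mu> \<theta> c x = \<mu> * min x c + \<theta> * max (x - c) 0"

lemma erlang_drain_lipschitz:
  assumes "0 < \<mu>" "0 < \<theta>"
  shows "\<bar>erlang_drain \<mu> \<theta> c x - erlang_drain \<mu> \<theta> c y\<bar> \<le> (\<mu> + \<theta>) * \<bar>x - y\<bar>"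
proof -
  have "erlang_drain \<mu> \<theta> c x - erlang_drain \<mu> \<theta> c y =
      \<mu> * (min x c - min y c) + \<theta> * (max (x - c) 0 - max (y - c) 0)"
    by (simp add: erlang_drain_def algebra_simps)
  also have "\<bar>\<dots>\<bar> \<le> \<bar>\<mu> * (min x c - min y c)\<bar> + \<bar>\<theta> * (max (x - c) 0 - max (y - c) 0)\<bar>"
    by (rule abs_triangle_ineq)
  also have "\<dots> \<le> \<mu> * \<bar>x - y\<bar> + \<theta> * \<bar>x - y\<bar>"
    using assms by (intro add_mono) (auto simp: abs_mult intro!: mult_left_mono)
  finally show ?thesis by (simp add: algebra_simps)
qed

text \<open>Since \<open>x = min x c + max (x - c) 0\<close>, an increment splits into a part below
  \<open>c\<close>, weighted by \<open>\<mu>\<close>, and a part above, weighted by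
  \<open>\<theta>\<close>.\<close>

lemma erlang_drain_increasing:
  assumes "x \<le> y"
  shows "min \<mu> \<theta> * (y - x) \<le> erlang_drain \<mu> \<theta> c y - erlang_drain \<mu> \<theta> c x"
proof -
  have "min \<mu> \<theta> * (y - x) = min \<mu> \<theta> * (min y c - min x c) + min \<mu> \<theta> * (max (y - c) 0 - max (x - c) 0)"
    unfolding distrib_left[symmetric] by (intro arg_cong2[where f = "(*)"] refl) (auto simp: min_def max_def)
  also have "\<dots> \<le> \<mu> * (min y c - min x c) + \<theta> * (max (y - c) 0 - max (x - c) 0)"
    using assms by (intro add_mono mult_right_mono) auto
  finally show ?thesis by (simp add: erlang_drain_def algebra_simps)
qed

lemma erlang_drain_dissipative:
  "min \<mu> \<theta> * (x - y)\<^sup>2 \<le> (x - y) * (erlang_drain \<mu> \<theta> c x - erlang_drain \<mu> \<theta> c y)"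
proof (cases "x \<le> y")
  case True
  from mult_left_mono[OF erlang_drain_increasing[OF this, of \<mu> \<theta> c], of "y - x"] True
  show ?thesis by (simp add: power2_eq_square algebra_simps)
next
  case False
  then have "y \<le> x" by simp
  from mult_left_mono[OF erlang_drain_increasing[OF this, of \<mu> \<theta> c], of "x - y"] this
  show ?thesis by (simp add: power2_eq_square algebra_simps)
qed

section \<open>Stability of the equilibrium\<close>

lemma tendsto_equilibrium:
  fixes q :: "real \<Rightarrow> real"
  assumes pos: "0 < \<mu>" "0 < \<theta>"
    and deriv: "\<And>t. 0 < t \<Longrightarrow> (q has_real_derivative lam - erlang_drain \<mu> \<theta> c (q t)) (at t)"
    and eq: "erlang_drain \<mu> \<theta> c x = lam"
  shows "(q \<longlongrightarrow> x) at_top"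
proof -
  define m where "m = min \<mu> \<theta>"
  have m: "m > 0" using pos by (simp add: m_def)
  \<comment> \<open>The weight \<open>exp (2 * m * t)\<close> is the largest exponential for which
    dissipativity still gives a nonpositive derivative; \<open>eq\<close> rewrites the drift as a
    difference of two drains. Time starts at 1 because \<open>deriv\<close> covers positive times
    only.\<close>
  define V where "V t = (q t - x)\<^sup>2 * exp (2 * m * t)" for t
  have V: "V t \<le> V 1" if "t \<ge> 1" for t
  proof (rule DERIV_nonpos_imp_nonincreasing[OF that])
    fix t :: real assume t: "1 \<le> t"
    let ?D = "exp (2 * m * t) * (2 * (m * (q t - x)\<^sup>2 - (q t - x) * (erlang_drain \<mu> \<theta> c (q t) - erlang_drain \<mu> \<theta> c x)))"
    have "(V has_real_derivative ?D) (at t)"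
      unfolding V_def using t
      by (auto intro!: derivative_eq_intros deriv simp: eq power2_eq_square algebra_simps)
    moreover have "?D \<le> 0"
      using erlang_drain_dissipative[of \<mu> \<theta> "q t" x c] by (intro mult_nonneg_nonpos) (auto simp: m_def)
    ultimately show "\<exists>y. DERIV V t :> y \<and> y \<le> 0" by blast
  qed
  have "((\<lambda>t. (q t - x)\<^sup>2) \<longlongrightarrow> 0) at_top"
  proof (rule tendsto_sandwich[where f = "\<lambda>_. 0"])
    show "((\<lambda>t. V 1 * exp (- (2 * m * t))) \<longlongrightarrow> 0) at_top" using m by real_asymp
    show "\<forall>\<^sub>F t in at_top. (q t - x)\<^sup>2 \<le> V 1 * exp (- (2 * m * t))"
      using eventually_ge_at_top[of 1]
    proof eventually_elim
      case (elim t)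
      have "(q t - x)\<^sup>2 = V t * exp (- (2 * m * t))" by (simp add: V_def exp_minus)
      then show ?case using mult_right_mono[OF V[OF elim], of "exp (- (2 * m * t))"] by simp
    qed
  qed auto
  then have "((\<lambda>t. sqrt ((q t - x)\<^sup>2)) \<longlongrightarrow> sqrt 0) at_top" by (intro tendsto_real_sqrt)
  then have "((\<lambda>t. q t - x) \<longlongrightarrow> 0) at_top" by (simp add: tendsto_rabs_zero_iff)
  then show ?thesis by (simp add: LIM_zero_iff)
qed

section \<open>From queue paths to the fluid equation\<close>

text \<open>Where \<open>\<eta> * y\<close> is large, the ratio is close to 1 uniformly. Where it is
  below a threshold \<open>Z\<close>, monotonicity bounds the count by \<open>p Z\<close>, and both
  \<open>p Z / \<eta>\<close> and \<open>y\<close> are small.\<close>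

lemma uniform_lln:
  fixes p :: "real \<Rightarrow> real"
  assumes mono: "\<And>y z. 0 \<le> y \<Longrightarrow> y \<le> z \<Longrightarrow> p y \<le> p z" and nonneg: "\<And>y. 0 \<le> y \<Longrightarrow> 0 \<le> p y"
    and lim: "((\<lambda>y. p y / y) \<longlongrightarrow> 1) at_top" and \<epsilon>: "0 < \<epsilon>" and A: "0 \<le> A"
  shows "\<forall>\<^sub>F \<eta> in at_top. \<forall>y\<in>{0..A}. \<bar>p (\<eta> * y) / \<eta> - y\<bar> \<le> \<epsilon>"
proof -
  \<comment> \<open>A relative error \<open>\<delta>\<close> at \<open>y \<le> A\<close> is an
    absolute error of at most \<open>A * \<delta>\<close>; adding 1 avoids dividing by 0 when
    \<open>A = 0\<close>.\<close>
  define \<delta> where "\<delta> = \<epsilon> / (A + 1)"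
  have \<delta>: "0 < \<delta>" "A * \<delta> \<le> \<epsilon>" using \<epsilon> A by (auto simp: \<delta>_def field_simps)
  from tendstoD[OF lim \<delta>(1)] obtain Y where Y: "\<And>y. y \<ge> Y \<Longrightarrow> \<bar>p y / y - 1\<bar> < \<delta>"
    by (auto simp: eventually_at_top_linorder dist_real_def)
  define Z where "Z = max Y 1"
  have Z: "Z > 0" "p Z \<ge> 0" using nonneg[of Z] by (auto simp: Z_def)
  show ?thesis
    using eventually_gt_at_top[of 0] eventually_ge_at_top[of "p Z / \<epsilon>"] eventually_ge_at_top[of "Z / \<epsilon>"]
  proof eventually_elim
    case (elim \<eta>)
    have le: "p Z / \<eta> \<le> \<epsilon>" "Z / \<eta> \<le> \<epsilon>" using elim \<epsilon> by (auto simp: field_simps)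
    show ?case
    proof
      fix y assume y: "y \<in> {0..A}"
      show "\<bar>p (\<eta> * y) / \<eta> - y\<bar> \<le> \<epsilon>"
      proof (cases "\<eta> * y \<ge> Z")
        case True
        then have y0: "y > 0" using Z elim y by (cases "y = 0") auto
        have "p (\<eta> * y) / \<eta> - y = y * (p (\<eta> * y) / (\<eta> * y) - 1)"
          using y0 elim by (simp add: field_simps)
        then have "\<bar>p (\<eta> * y) / \<eta> - y\<bar> = \<bar>y * (p (\<eta> * y) / (\<eta> * y) - 1)\<bar>"
          by (rule arg_cong)
        also have "\<dots> \<le> y * \<delta>"
          using y0 Y[of "\<eta> * y"] True by (auto simp: abs_mult Z_def intro!: mult_left_mono)
        also have "\<dots> \<le> A * \<delta>" using y \<delta> by (intro mult_right_mono) auto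
        also have "\<dots> \<le> \<epsilon>" by (rule \<delta>)
        finally show ?thesis .
      next
        case False
        have "p (\<eta> * y) / \<eta> \<le> p Z / \<eta>" "0 \<le> p (\<eta> * y) / \<eta>"
          using False elim y by (auto intro!: divide_right_mono mono nonneg divide_nonneg_nonneg)
        moreover have "y \<le> Z / \<eta>" using False elim by (simp add: field_simps)
        ultimately show ?thesis using le y by auto
      qed
    qed
  qed
qed

text \<open>Gauge integrability alone is not preserved by \<open>min\<close> and \<open>max\<close>.
  Nonnegativity upgrades it to absolute integrability, which is.\<close>

lemma integrable_min_max:
  fixes f :: "real \<Rightarrow> real"
  assumes "f integrable_on {a..b}" "\<And>x. 0 \<le> f x"
  shows "(\<lambda>x. min (f x) c) integrable_on {a..b}" "(\<lambda>x. max (f x - c) 0) integrable_on {a..b}"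
proof -
  have f: "f absolutely_integrable_on {a..b}"
    using assms by (intro nonnegative_absolutely_integrable_1) auto
  have c: "(\<lambda>_. c) absolutely_integrable_on {a..b}" for c :: real
    using absolutely_integrable_on_const by fastforce
  show "(\<lambda>x. min (f x) c) integrable_on {a..b}"
    using absolutely_integrable_min_1[OF f c] by (rule set_lebesgue_integral_eq_integral(1))
  show "(\<lambda>x. max (f x - c) 0) integrable_on {a..b}"
    using absolutely_integrable_max_1[OF set_integral_diff(1)[OF f c] c] by (rule set_lebesgue_integral_eq_integral(1))
qed

lemma integral_increment_bound:
  fixes f :: "real \<Rightarrow> real"
  assumes f: "f integrable_on {0..r}" and v: "0 \<le> v" "v \<le> r"
    and B: "\<And>z. v \<le> z \<Longrightarrow> z \<le> r \<Longrightarrow> \<bar>f z - m\<bar> \<le> B"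
  shows "\<bar>integral {0..r} f - integral {0..v} f - (r - v) * m\<bar> \<le> B * (r - v)"
proof -
  have fvr: "f integrable_on {v..r}"
    using v by (intro integrable_subinterval_real[OF f]) auto
  have "integral {0..r} f - integral {0..v} f - (r - v) * m = integral {v..r} f - integral {v..r} (\<lambda>_. m)"
    using Henstock_Kurzweil_Integration.integral_combine[OF v f] v by simp
  also have "\<dots> = integral {v..r} (\<lambda>z. f z - m)"
    by (intro Henstock_Kurzweil_Integration.integral_diff[symmetric] fvr) auto
  also have "norm \<dots> \<le> integral {v..r} (\<lambda>_. B)"
    by (intro Henstock_Kurzweil_Integration.integral_norm_bound_integral integrable_diff fvr) (use B in auto)
  finally show ?thesis using v by (simp add: mult.commute)
qed

text \<open>A quantitative substitute for compactness: since the limit values at the three times \<open>0\<close>, \<open>s\<close>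
  and \<open>u\<close> are enough, one path per pair \<open>(s, u)\<close> suffices, and no common exceptional null set
  for uncountably many times is needed.\<close>
lemma fluid_increment_bound:
  fixes X :: "nat \<Rightarrow> real \<Rightarrow> real" and p :: "nat \<Rightarrow> real \<Rightarrow> real" and \<eta> :: "nat \<Rightarrow> real"
  assumes pos: "0 < lam" "0 < \<mu>" "0 < \<theta>" "0 < c"
    and \<eta>: "filterlim \<eta> at_top sequentially" "\<And>k. 0 < \<eta> k"
    and mono: "\<And>i y z. i \<in> {1, 2, 3} \<Longrightarrow> 0 \<le> y \<Longrightarrow> y \<le> z \<Longrightarrow> p i y \<le> p i z"
    and nonneg: "\<And>i y. 0 \<le> p i y"
    and lln: "\<And>i. i \<in> {1, 2, 3} \<Longrightarrow> ((\<lambda>y. p i y / y) \<longlongrightarrow> 1) at_top"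
    and X_nonneg: "\<And>k t. 0 \<le> X k t"
    and X_int: "\<And>k t. 0 \<le> t \<Longrightarrow> X k integrable_on {0..t}"
    and X_eq: "\<And>k t. 0 \<le> t \<Longrightarrow> X k t = X k 0 + p 1 (\<eta> k * (lam * t)) / \<eta> k
      - p 2 (\<eta> k * integral {0..t} (\<lambda>s. \<mu> * min (X k s) c)) / \<eta> k
      - p 3 (\<eta> k * integral {0..t} (\<lambda>s. \<theta> * max (X k s - c) 0)) / \<eta> k"
    and lim: "(\<lambda>k. X k 0) \<longlonglongrightarrow> x0" "(\<lambda>k. X k s) \<longlonglongrightarrow> xs" "(\<lambda>k. X k u) \<longlonglongrightarrow> xu"
    and s: "0 \<le> s" "s \<le> T" and u: "0 \<le> u" "u \<le> T"
  defines "K \<equiv> x0 + lam * T + 1"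
  defines "L \<equiv> lam + (\<mu> + \<theta>) * K"
  shows "\<bar>xu - xs - (u - s) * (lam - erlang_drain \<mu> \<theta> c xs)\<bar> \<le> (\<mu> + \<theta>) * L * (u - s)\<^sup>2"
proof -
  let ?m = "erlang_drain \<mu> \<theta> c"
  define d where "d = \<bar>u - s\<bar>"
  have T: "0 \<le> T" using s by simp
  have x0: "0 \<le> x0" using X_nonneg by (intro LIMSEQ_le_const[OF lim(1)]) auto
  have K: "0 < K" using x0 T pos by (simp add: K_def add_nonneg_pos)
  \<comment> \<open>A common range for the clocks of all three Poisson processes up to time
    \<open>T\<close>, so that one uniform law of large numbers serves each.\<close>
  define A where "A = (lam + \<mu> * K + \<theta> * K) * T"
  have A: "0 \<le> A" "lam * T \<le> A" "\<mu> * K * T \<le> A" "\<theta> * K * T \<le> A"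
    using pos K T by (auto simp: A_def algebra_simps)
  define a where "a k t = integral {0..t} (\<lambda>s. \<mu> * min (X k s) c)" for k t
  define b where "b k t = integral {0..t} (\<lambda>s. \<theta> * max (X k s - c) 0)" for k t
  have int_a: "(\<lambda>s. \<mu> * min (X k s) c) integrable_on {0..t}" if "0 \<le> t" for k t
    using integrable_min_max(1)[OF X_int[OF that] X_nonneg] by (rule integrable_on_mult_right)
  have int_b: "(\<lambda>s. \<theta> * max (X k s - c) 0) integrable_on {0..t}" if "0 \<le> t" for k t
    using integrable_min_max(2)[OF X_int[OF that] X_nonneg] by (rule integrable_on_mult_right)
  have int_m: "(\<lambda>z. ?m (X k z)) integrable_on {0..t}"
    and ab: "a k t + b k t = integral {0..t} (\<lambda>z. ?m (X k z))" if "0 \<le> t" for k t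
    unfolding erlang_drain_def a_def b_def
    by (intro integrable_add int_a int_b that)
      (intro Henstock_Kurzweil_Integration.integral_add[symmetric] int_a int_b that)
  have bound: "\<bar>xu - xs - (u - s) * (lam - ?m xs)\<bar> \<le> (\<mu> + \<theta>) * (L * d + 6 * \<epsilon>) * d + 6 * \<epsilon>"
    if \<epsilon>: "0 < \<epsilon>" "\<epsilon> \<le> 1 / 2" for \<epsilon> :: real
  proof -
    have u_lln: "\<forall>\<^sub>F k in sequentially. \<forall>y\<in>{0..A}. \<bar>p i (\<eta> k * y) / \<eta> k - y\<bar> \<le> \<epsilon>" if "i \<in> {1, 2, 3}" for i
      using uniform_lln[OF mono[OF that] nonneg lln[OF that] \<epsilon>(1) A(1)] \<eta>(1)
      by (rule eventually_compose_filterlim)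
    have i123: "1 \<in> {1, 2, 3::nat}" "2 \<in> {1, 2, 3::nat}" "3 \<in> {1, 2, 3::nat}" by auto
    have "\<forall>\<^sub>F k in sequentially. X k 0 < x0 + 1 / 2"
      by (intro order_tendstoD(2)[OF lim(1)]) simp
    with u_lln[OF i123(1)] u_lln[OF i123(2)] u_lln[OF i123(3)]
    have ev: "\<forall>\<^sub>F k in sequentially. \<bar>X k u - X k s - (u - s) * (lam - ?m (X k s))\<bar>
        \<le> (\<mu> + \<theta>) * (L * d + 6 * \<epsilon>) * d + 6 * \<epsilon>"
    proof eventually_elim
      case (elim k)
      have le_T: "x * t \<le> x * T" if "t \<le> T" "0 \<le> x" for x t
        using that by (rule mult_left_mono)
      have lamt: "lam * t \<in> {0..A}" if "0 \<le> t" "t \<le> T" for t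
        using order_trans[OF le_T[OF that(2)] A(2)] that pos by auto
      \<comment> \<open>Dropping the departures bounds the path by initial content plus arrivals.
        The 1 in \<open>K\<close> pays for two errors of at most \<open>1 / 2\<close>: that of the
        initial value and that of the arrivals.\<close>
      have XK: "X k t \<le> K" if t: "0 \<le> t" "t \<le> T" for t
      proof -
        have "X k t \<le> X k 0 + p 1 (\<eta> k * (lam * t)) / \<eta> k"
        proof -
          have "0 \<le> p i y / \<eta> k" for i y using \<eta>(2)[of k] nonneg[of i y] by simp
          from X_eq[OF t(1), of k] this[of 2 "\<eta> k * a k t"] this[of 3 "\<eta> k * b k t"]
          show ?thesis unfolding a_def b_def by linarith
        qed
        also have "\<dots> \<le> (x0 + 1 / 2) + (lam * t + \<epsilon>)"
          using elim bspec[OF elim(1) lamt[OF t]] by (intro add_mono) auto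
        also have "\<dots> \<le> K" using \<epsilon> le_T[OF t(2), of lam] pos unfolding K_def by linarith
        finally show ?thesis .
      qed
      have a: "a k t \<in> {0..A}" and b: "b k t \<in> {0..A}" if t: "0 \<le> t" "t \<le> T" for t
      proof -
        have "0 \<le> a k t" unfolding a_def
          using pos X_nonneg by (intro Henstock_Kurzweil_Integration.integral_nonneg int_a t) auto
        moreover have "a k t \<le> integral {0..t} (\<lambda>_. \<mu> * K)"
          unfolding a_def using pos XK t
          by (intro integral_le int_a) (auto simp: min_le_iff_disj intro!: mult_left_mono)
        moreover have "\<dots> \<le> \<mu> * K * T"
          using le_T[OF t(2), of "\<mu> * K"] t pos K by (simp only: integral_const_real) (simp add: mult.commute)
        ultimately show "a k t \<in> {0..A}" using A by auto
        have "0 \<le> b k t" unfolding b_def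
          using pos by (intro Henstock_Kurzweil_Integration.integral_nonneg int_b t) auto
        moreover have "b k t \<le> integral {0..t} (\<lambda>_. \<theta> * K)"
          unfolding b_def using pos XK t K
          by (intro integral_le int_b) (auto intro!: mult_left_mono order_trans[OF _ XK])
        moreover have "\<dots> \<le> \<theta> * K * T"
          using le_T[OF t(2), of "\<theta> * K"] t pos K by (simp only: integral_const_real) (simp add: mult.commute)
        ultimately show "b k t \<in> {0..A}" using A by auto
      qed
      define I where "I t = integral {0..t} (\<lambda>z. ?m (X k z))" for t
      \<comment> \<open>Each of the three processes contributes one \<open>\<epsilon>\<close>; a
        difference of two times then costs \<open>6 * \<epsilon>\<close>.\<close>
      have X_approx: "\<bar>X k t - (X k 0 + lam * t - I t)\<bar> \<le> 3 * \<epsilon>" if t: "0 \<le> t" "t \<le> T" for t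
      proof -
        have "X k t = X k 0 + p 1 (\<eta> k * (lam * t)) / \<eta> k - p 2 (\<eta> k * a k t) / \<eta> k - p 3 (\<eta> k * b k t) / \<eta> k"
          unfolding a_def b_def by (rule X_eq[OF t(1)])
        moreover have "I t = a k t + b k t" using ab[OF t(1)] by (simp add: I_def)
        ultimately show ?thesis
          using bspec[OF elim(1) lamt[OF t]] bspec[OF elim(2) a[OF t]] bspec[OF elim(3) b[OF t]]
          unfolding abs_le_iff by linarith
      qed
      have incr: "\<bar>X k r - X k v - (lam * (r - v) - (I r - I v))\<bar> \<le> 6 * \<epsilon>"
        if "0 \<le> r" "r \<le> T" "0 \<le> v" "v \<le> T" for r v
        using X_approx[of r] X_approx[of v] that
        unfolding abs_le_iff right_diff_distrib by linarith
      \<comment> \<open>Both orders of the times are covered because \<open>u\<close> may precede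
        \<open>s\<close>, as a two-sided derivative demands.\<close>
      have I_bound: "\<bar>I r - I v - (r - v) * m\<bar> \<le> B * \<bar>r - v\<bar>"
        if rv: "0 \<le> r" "0 \<le> v" and B: "\<And>z. min r v \<le> z \<Longrightarrow> z \<le> max r v \<Longrightarrow> \<bar>?m (X k z) - m\<bar> \<le> B" for r v m B
      proof (cases "v \<le> r")
        case True
        then show ?thesis
          using integral_increment_bound[OF int_m[OF rv(1), of k] rv(2) True, of m B] B by (simp add: I_def)
      next
        case False
        then have vr: "r \<le> v" by simp
        have "\<bar>I v - I r - (v - r) * m\<bar> \<le> B * (v - r)"
          unfolding I_def using vr B by (intro integral_increment_bound int_m rv) (auto simp: min_absorb1 max_absorb2)
        moreover have "I v - I r - (v - r) * m = - (I r - I v - (r - v) * m)" by (simp add: algebra_simps)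
        ultimately show ?thesis using vr by (simp add: abs_minus_commute)
      qed
      have m_bound: "\<bar>?m (X k z) - lam\<bar> \<le> L" if "0 \<le> z" "z \<le> T" for z
      proof -
        have "0 \<le> ?m (X k z)" using pos X_nonneg[of k z] by (simp add: erlang_drain_def)
        moreover have "?m (X k z) \<le> \<mu> * K + \<theta> * K"
          unfolding erlang_drain_def using XK[OF that] pos K X_nonneg[of k z]
          by (intro add_mono mult_left_mono) auto
        ultimately show ?thesis using pos unfolding L_def abs_le_iff by (simp add: algebra_simps)
      qed
      \<comment> \<open>This substitutes for continuity of the limit: between \<open>s\<close> and
        \<open>u\<close> the path stays near \<open>X k s\<close>, so its drain stays near the drain
        at \<open>s\<close>.\<close>
      have lip: "\<bar>X k z - X k s\<bar> \<le> L * d + 6 * \<epsilon>" if z: "min u s \<le> z" "z \<le> max u s" for z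
      proof -
        have zT: "0 \<le> z" "z \<le> T" using z s u by (auto simp: min_def max_def split: if_splits)
        have zd: "\<bar>z - s\<bar> \<le> d" using z by (auto simp: d_def min_def max_def split: if_splits)
        have L0: "0 \<le> L" using m_bound[OF s] by linarith
        have "\<bar>I z - I s - (z - s) * lam\<bar> \<le> L * \<bar>z - s\<bar>"
          using zT s by (intro I_bound m_bound) (auto simp: min_def max_def split: if_splits)
        also have "\<dots> \<le> L * d" using zd L0 by (rule mult_left_mono)
        finally have "\<bar>I z - I s - (z - s) * lam\<bar> \<le> L * d" .
        then show ?thesis using incr[of z s] zT s unfolding abs_le_iff by (simp add: mult.commute[of lam])
      qed
      have "\<bar>I u - I s - (u - s) * ?m (X k s)\<bar> \<le> ((\<mu> + \<theta>) * (L * d + 6 * \<epsilon>)) * \<bar>u - s\<bar>"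
      proof (intro I_bound u s)
        fix z assume "min u s \<le> z" "z \<le> max u s"
        then show "\<bar>?m (X k z) - ?m (X k s)\<bar> \<le> (\<mu> + \<theta>) * (L * d + 6 * \<epsilon>)"
          using pos by (intro order_trans[OF erlang_drain_lipschitz] mult_left_mono lip) auto
      qed
      then have "\<bar>I u - I s - (u - s) * ?m (X k s)\<bar> \<le> (\<mu> + \<theta>) * (L * d + 6 * \<epsilon>) * d"
        by (simp add: d_def)
      moreover have "(u - s) * (lam - ?m (X k s)) = lam * (u - s) - (u - s) * ?m (X k s)"
        by (simp add: algebra_simps)
      ultimately show ?case using incr[OF u s] unfolding abs_le_iff by linarith
    qed
    have "(\<lambda>k. ?m (X k s)) \<longlonglongrightarrow> ?m xs"
      unfolding erlang_drain_def by (intro tendsto_intros lim)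
    then have "(\<lambda>k. \<bar>X k u - X k s - (u - s) * (lam - ?m (X k s))\<bar>) \<longlonglongrightarrow> \<bar>xu - xs - (u - s) * (lam - ?m xs)\<bar>"
      by (intro tendsto_intros lim)
    from tendsto_upperbound[OF this ev] show ?thesis by simp
  qed
  \<comment> \<open>The number of paths went to infinity for fixed \<open>\<epsilon>\<close>; now
    \<open>\<epsilon>\<close> tends to 0 and leaves only the quadratic term.\<close>
  have "((\<lambda>\<epsilon>. (\<mu> + \<theta>) * (L * d + 6 * \<epsilon>) * d + 6 * \<epsilon>) \<longlongrightarrow> (\<mu> + \<theta>) * (L * d + 6 * 0) * d + 6 * 0) (at_right 0)"
    by (intro tendsto_intros)
  moreover have "\<forall>\<^sub>F \<epsilon> in at_right 0. \<bar>xu - xs - (u - s) * (lam - ?m xs)\<bar> \<le> (\<mu> + \<theta>) * (L * d + 6 * \<epsilon>) * d + 6 * \<epsilon>"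
    using eventually_at_right_less[of 0] eventually_at_right_real[of 0 "1/2"]
    by (auto elim!: eventually_mono intro!: bound)
  ultimately have "\<bar>xu - xs - (u - s) * (lam - ?m xs)\<bar> \<le> (\<mu> + \<theta>) * (L * d + 6 * 0) * d + 6 * 0"
    by (rule tendsto_lowerbound) simp
  then show ?thesis by (simp add: d_def power2_eq_square mult.assoc)
qed

lemma has_real_derivative_of_quadratic_bound:
  fixes q :: "real \<Rightarrow> real"
  assumes "0 < \<delta>" "\<And>u. u \<in> S \<Longrightarrow> \<bar>u - s\<bar> < \<delta> \<Longrightarrow> \<bar>q u - q s - (u - s) * D\<bar> \<le> C * (u - s)\<^sup>2"
  shows "(q has_real_derivative D) (at s within S)"
  unfolding has_field_derivative_iff
proof (rule LIM_zero_cancel, rule Lim_null_comparison)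
  show "\<forall>\<^sub>F u in at s within S. norm ((q u - q s) / (u - s) - D) \<le> C * \<bar>u - s\<bar>"
    unfolding eventually_at
  proof (intro exI conjI ballI impI)
    fix u assume u: "u \<in> S" "u \<noteq> s \<and> dist u s < \<delta>"
    have "(q u - q s) / (u - s) - D = (q u - q s - (u - s) * D) / (u - s)"
      using u by (simp add: field_simps)
    moreover have "\<bar>q u - q s - (u - s) * D\<bar> / \<bar>u - s\<bar> \<le> C * \<bar>u - s\<bar>"
      using assms(2)[of u] u by (subst pos_divide_le_eq) (auto simp: dist_real_def power2_eq_square mult.assoc)
    ultimately show "norm ((q u - q s) / (u - s) - D) \<le> C * \<bar>u - s\<bar>" by (simp add: abs_divide)
  qed (use assms in auto)
qed (auto intro!: tendsto_eq_intros)

section \<open>The scaled queue\<close>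

context scaled_erlang_a
begin

lemma poisson_P: "poisson_process 1 (P 1)" "poisson_process 1 (P 2)" "poisson_process 1 (P 3)"
  using poisson by auto

text \<open>Evaluating the uniform law at the endpoint \<open>y = a\<close> includes
  \<open>a = 0\<close>, where \<open>\<eta> * a\<close> does not tend to infinity.\<close>

lemma arrivals_lln:
  assumes "0 \<le> a"
  shows "AE \<omega> in M. ((\<lambda>\<eta>. real (P 1 (\<eta> * a) \<omega>) / \<eta>) \<longlongrightarrow> a) at_top"
  using poisson_process_lln[OF poisson_P(1)] AE_space
proof eventually_elim
  case (elim \<omega>)
  show ?case
  proof (rule tendstoI)
    fix e :: real assume e: "0 < e"
    have "\<forall>\<^sub>F \<eta> in at_top. \<forall>y\<in>{0..a}. \<bar>real (P 1 (\<eta> * y) \<omega>) / \<eta> - y\<bar> \<le> e / 2"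
      by (rule uniform_lln) (use elim e assms poisson_processD(3)[OF poisson_P(1)] in auto)
    then show "\<forall>\<^sub>F \<eta> in at_top. dist (real (P 1 (\<eta> * a) \<omega>) / \<eta>) a < e"
    proof eventually_elim
      case (elim \<eta>)
      from bspec[OF this, of a] assms e show ?case by (simp add: dist_real_def)
    qed
  qed
qed

lemma fluid_limit_increment:
  assumes fluid: "\<And>t. t \<ge> 0 \<Longrightarrow> AE \<omega> in M. ((\<lambda>\<eta>. real (Q \<eta> t \<omega>) / \<eta>) \<longlongrightarrow> q t) at_top"
    and s: "0 \<le> s" "s \<le> T" and u: "0 \<le> u" "u \<le> T"
  shows "\<bar>q u - q s - (u - s) * (lam - erlang_drain \<mu> \<theta> (real c) (q s))\<bar>
    \<le> (\<mu> + \<theta>) * (lam + (\<mu> + \<theta>) * (q 0 + lam * T + 1)) * (u - s)\<^sup>2" (is ?claim)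
proof -
  \<comment> \<open>Each \<open>\<eta>\<close> has its own exceptional set in the queue equation;
    along a sequence these sets are countably many.\<close>
  define \<eta> where "\<eta> k = real (Suc k)" for k
  have \<eta>: "filterlim \<eta> at_top sequentially" "\<And>k. 0 < \<eta> k"
    unfolding \<eta>_def by (auto intro!: filterlim_compose[OF filterlim_real_sequentially filterlim_Suc] simp del: of_nat_Suc)
  have "AE \<omega> in M. \<forall>k. (\<forall>t\<ge>0. (\<lambda>s. real (Q (\<eta> k) s \<omega>)) integrable_on {0..t})"
    unfolding AE_all_countable by (intro allI Q_paths_integrable \<eta>)
  moreover have "AE \<omega> in M. \<forall>k. \<forall>t\<ge>0.
         real (Q (\<eta> k) t \<omega>) = real (Q (\<eta> k) 0 \<omega>) + real (P 1 (\<eta> k * lam * t) \<omega>)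
           - real (P 2 (integral {0..t} (\<lambda>s. \<mu> * min (real (Q (\<eta> k) s \<omega>)) (\<eta> k * real c))) \<omega>)
           - real (P 3 (integral {0..t} (\<lambda>s. \<theta> * max (real (Q (\<eta> k) s \<omega>) - \<eta> k * real c) 0)) \<omega>)"
    unfolding AE_all_countable by (intro allI Q_equation \<eta>)
  moreover note AE_space poisson_process_lln[OF poisson_P(1)] poisson_process_lln[OF poisson_P(2)]
    poisson_process_lln[OF poisson_P(3)] fluid[of 0, simplified] fluid[OF s(1)] fluid[OF u(1)]
  \<comment> \<open>The claim does not mention \<open>\<omega>\<close>, so holding almost surely in
    a probability space means holding.\<close>
  ultimately have "AE \<omega> in M. ?claim"
  proof eventually_elim
    case (elim \<omega>)
    define X where "X k t = real (Q (\<eta> k) t \<omega>) / \<eta> k" for k t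
    have lim: "(\<lambda>k. X k t) \<longlonglongrightarrow> q t" if "((\<lambda>\<eta>. real (Q \<eta> t \<omega>) / \<eta>) \<longlongrightarrow> q t) at_top" for t
      unfolding X_def using filterlim_compose[OF that \<eta>(1)] .
    have QX: "real (Q (\<eta> k) t \<omega>) = \<eta> k * X k t" for k t
      using \<eta>(2)[of k] by (simp add: X_def)
    have mins: "\<mu> * min (real (Q (\<eta> k) t \<omega>)) (\<eta> k * real c) = \<eta> k * (\<mu> * min (X k t) (real c))"
      "\<theta> * max (real (Q (\<eta> k) t \<omega>) - \<eta> k * real c) 0 = \<eta> k * (\<theta> * max (X k t - real c) 0)" for k t
      unfolding QX using \<eta>(2)[of k] by (auto simp: min_def max_def algebra_simps)
    show ?claim
    proof (rule fluid_increment_bound[where X = X and p = "\<lambda>i y. real (P i y \<omega>)" and \<eta> = \<eta>])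
      show "X k integrable_on {0..t}" if "0 \<le> t" for k t
      proof -
        have "(\<lambda>s. real (Q (\<eta> k) s \<omega>) * (1 / \<eta> k)) integrable_on {0..t}"
          using elim(1) that by (intro integrable_on_mult_left) blast
        then show ?thesis by (simp add: X_def[abs_def])
      qed
      show "X k t = X k 0 + real (P 1 (\<eta> k * (lam * t)) \<omega>) / \<eta> k
        - real (P 2 (\<eta> k * integral {0..t} (\<lambda>s. \<mu> * min (X k s) (real c))) \<omega>) / \<eta> k
        - real (P 3 (\<eta> k * integral {0..t} (\<lambda>s. \<theta> * max (X k s - real c) 0)) \<omega>) / \<eta> k"
        if "0 \<le> t" for k t
      proof -
        have "real (Q (\<eta> k) t \<omega>) = real (Q (\<eta> k) 0 \<omega>) + real (P 1 (\<eta> k * lam * t) \<omega>)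
           - real (P 2 (\<eta> k * integral {0..t} (\<lambda>s. \<mu> * min (X k s) (real c))) \<omega>)
           - real (P 3 (\<eta> k * integral {0..t} (\<lambda>s. \<theta> * max (X k s - real c) 0)) \<omega>)"
          using elim(2)[rule_format, OF that, of k] unfolding mins integral_mult_right .
        then show ?thesis
          unfolding X_def[of k t] X_def[of k 0] by (simp only: add_divide_distrib diff_divide_distrib mult.assoc)
      qed
      show "real (P i y \<omega>) \<le> real (P i z \<omega>)" if "i \<in> {1, 2, 3}" "0 \<le> y" "y \<le> z" for i y z
        using poisson_processD(3)[OF poisson[OF that(1)] elim(3) that(2,3)] by simp
      show "((\<lambda>y. real (P i y \<omega>) / y) \<longlongrightarrow> 1) at_top" if "i \<in> {1, 2, 3}" for i
        using elim that by auto
      show "0 \<le> X k t" for k t using \<eta>(2)[of k] by (simp add: X_def)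
    qed (use rates_pos servers_pos \<eta> s u elim lim in auto)
  qed
  then show ?claim by simp
qed

lemma fluid_limit_ode:
  assumes fluid: "\<And>t. t \<ge> 0 \<Longrightarrow> AE \<omega> in M. ((\<lambda>\<eta>. real (Q \<eta> t \<omega>) / \<eta>) \<longlongrightarrow> q t) at_top"
    and s: "0 \<le> s"
  shows "(q has_real_derivative lam - erlang_drain \<mu> \<theta> (real c) (q s)) (at s within {0..})"
proof (rule has_real_derivative_of_quadratic_bound[where \<delta> = 1])
  \<comment> \<open>Taking \<open>T = s + 1\<close> covers every \<open>u\<close> within distance 1
    of \<open>s\<close>, so one constant works for all of them.\<close>
  fix u assume "u \<in> {0..}" "\<bar>u - s\<bar> < 1"
  then show "\<bar>q u - q s - (u - s) * (lam - erlang_drain \<mu> \<theta> (real c) (q s))\<bar>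
    \<le> (\<mu> + \<theta>) * (lam + (\<mu> + \<theta>) * (q 0 + lam * (s + 1) + 1)) * (u - s)\<^sup>2"
    using fluid s by (intro fluid_limit_increment) auto
qed simp

lemma queue_le:
  assumes "0 < \<eta>"
  shows "AE \<omega> in M. \<forall>t\<ge>0. real (Q \<eta> t \<omega>) \<le> real (Q \<eta> 0 \<omega>) + real (P 1 (\<eta> * lam * t) \<omega>)"
  using Q_equation[OF assms]
proof eventually_elim
  case (elim \<omega>)
  show ?case
  proof (intro allI impI)
    fix t :: real assume "0 \<le> t"
    \<comment> \<open>The departure counts are natural numbers whatever their random clocks are, so
      they can be discarded unexamined.\<close>
    have sub: "x \<le> y" if "x = y - real m - real n" for x y :: real and m n
      using that by simp
    show "real (Q \<eta> t \<omega>) \<le> real (Q \<eta> 0 \<omega>) + real (P 1 (\<eta> * lam * t) \<omega>)"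
      by (rule sub, rule elim[rule_format, OF \<open>0 \<le> t\<close>])
  qed
qed

text \<open>Almost sure convergence alone would let mass escape to infinity. \<open>mean0\<close>
  excludes this at time 0, the Poisson mean excludes it for the arrivals, and the domination carries
  it over to the queue at time \<open>t\<close>.\<close>

lemma queue_L1:
  assumes fluid: "\<And>t. t \<ge> 0 \<Longrightarrow> AE \<omega> in M. ((\<lambda>\<eta>. real (Q \<eta> t \<omega>) / \<eta>) \<longlongrightarrow> q t) at_top"
    and int0: "\<And>\<eta>. \<eta> > 0 \<Longrightarrow> integrable M (\<lambda>\<omega>. real (Q \<eta> 0 \<omega>))"
    and mean0: "((\<lambda>\<eta>. expectation (\<lambda>\<omega>. real (Q \<eta> 0 \<omega>)) / \<eta>) \<longlongrightarrow> q 0) at_top"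
    and t: "0 \<le> t"
  shows "0 < \<eta> \<Longrightarrow> integrable M (\<lambda>\<omega>. real (Q \<eta> t \<omega>))"
    and "((\<lambda>\<eta>. expectation (\<lambda>\<omega>. \<bar>real (Q \<eta> t \<omega>) / \<eta> - q t\<bar>)) \<longlongrightarrow> 0) at_top"
proof -
  note P1 = poisson_process_mean[OF poisson_P(1), simplified]
  have Z: "integrable M (\<lambda>\<omega>. real (Q \<eta> 0 \<omega>) + real (P 1 (\<eta> * lam * t) \<omega>))" if "0 < \<eta>" for \<eta>
    using int0 P1 that t rates_pos by (intro Bochner_Integration.integrable_add) auto
  show "integrable M (\<lambda>\<omega>. real (Q \<eta> t \<omega>))" if "0 < \<eta>" for \<eta>
  proof (rule Bochner_Integration.integrable_bound[OF Z[OF that]])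
    note [measurable] = Q_measurable[OF that t]
    show "(\<lambda>\<omega>. real (Q \<eta> t \<omega>)) \<in> borel_measurable M" by measurable
    show "AE \<omega> in M. norm (real (Q \<eta> t \<omega>)) \<le> norm (real (Q \<eta> 0 \<omega>) + real (P 1 (\<eta> * lam * t) \<omega>))"
      using queue_le[OF that] by eventually_elim (use t in auto)
  qed
  show "((\<lambda>\<eta>. expectation (\<lambda>\<omega>. \<bar>real (Q \<eta> t \<omega>) / \<eta> - q t\<bar>)) \<longlongrightarrow> 0) at_top"
  proof (rule tendsto_at_top_positive_sequences)
    fix X :: "nat \<Rightarrow> real" assume X: "filterlim X at_top sequentially" "\<And>k. 0 < X k"
    define Z where "Z k \<omega> = (real (Q (X k) 0 \<omega>) + real (P 1 (X k * lam * t) \<omega>)) / X k" for k \<omega>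
    show "(\<lambda>k. expectation (\<lambda>\<omega>. \<bar>real (Q (X k) t \<omega>) / X k - q t\<bar>)) \<longlonglongrightarrow> 0"
    proof (rule tendsto_L1_dominated[where Z = Z and z = "q 0 + lam * t"])
      note [measurable] = Q_measurable[OF X(2) t]
      show "(\<lambda>\<omega>. real (Q (X k) t \<omega>) / X k) \<in> borel_measurable M" for k by measurable
      show "integrable M (Z k)" for k
        unfolding Z_def[abs_def] by (intro integrable_divide Z X)
      show "AE \<omega> in M. 0 \<le> real (Q (X k) t \<omega>) / X k \<and> real (Q (X k) t \<omega>) / X k \<le> Z k \<omega>" for k
        using queue_le[OF X(2)[of k]] X(2)[of k]
        by (auto elim!: eventually_mono simp: Z_def t intro!: divide_right_mono)
      show "AE \<omega> in M. (\<lambda>k. real (Q (X k) t \<omega>) / X k) \<longlonglongrightarrow> q t"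
        using fluid[OF t] by eventually_elim (rule filterlim_compose[OF _ X(1)])
      have "AE \<omega> in M. ((\<lambda>\<eta>. real (P 1 (\<eta> * (lam * t)) \<omega>) / \<eta>) \<longlongrightarrow> lam * t) at_top"
        using rates_pos t by (intro arrivals_lln) auto
      with fluid[of 0, simplified]
      show "AE \<omega> in M. (\<lambda>k. Z k \<omega>) \<longlonglongrightarrow> q 0 + lam * t"
      proof eventually_elim
        case (elim \<omega>)
        from filterlim_compose[OF tendsto_add[OF elim] X(1)] show ?case
          by (simp add: Z_def add_divide_distrib mult.assoc)
      qed
      have "expectation (Z k) = expectation (\<lambda>\<omega>. real (Q (X k) 0 \<omega>)) / X k + lam * t" for k
        unfolding Z_def[abs_def] using int0 P1 X(2)[of k] t rates_pos
        by (simp add: add_divide_distrib mult.assoc)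
      with filterlim_compose[OF tendsto_add[OF mean0 tendsto_const] X(1)]
      show "(\<lambda>k. expectation (Z k)) \<longlonglongrightarrow> q 0 + lam * t" by simp
    qed
  qed
qed

section \<open>Mean wait and mean overlap\<close>

lemma wait_mean:
  assumes \<eta>: "0 < \<eta>" and t: "0 \<le> t" and Qint: "integrable M (\<lambda>\<omega>. real (Q \<eta> t \<omega>))"
  shows "integrable M (W \<eta> t)"
    and "\<bar>expectation (W \<eta> t) - fluid_wait \<mu> \<theta> (real c) x\<bar>
      \<le> 1 / (\<mu> * (\<eta> * real c)) + expectation (\<lambda>\<omega>. \<bar>real (Q \<eta> t \<omega>) / \<eta> - x\<bar>) / (\<mu> * real c)"
proof -
  note pos = rates_pos(2,3)
  have c: "0 < real c" using servers_pos by simp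
  define m where "m \<omega> = mean_virtual_wait \<mu> \<theta> (\<eta> * real c) (Q \<eta> t \<omega>)" for \<omega>
  define f where "f = fluid_wait \<mu> \<theta> (real c)"
  note [measurable] = Q_measurable[OF \<eta> t] W_measurable[OF \<eta> t]
  have [measurable]: "m \<in> borel_measurable M" unfolding m_def by measurable
  have m_bounds: "f (real (Q \<eta> t \<omega>) / \<eta>) \<le> m \<omega>" "m \<omega> \<le> 1 / (\<mu> * (\<eta> * real c)) + f (real (Q \<eta> t \<omega>) / \<eta>)" for \<omega>
    unfolding m_def f_def by (rule mean_virtual_wait_bounds[OF pos c \<eta>])+
  have f_lip: "\<bar>f v - f w\<bar> \<le> \<bar>v - w\<bar> / (\<mu> * real c)" for v w
    unfolding f_def by (rule fluid_wait_lipschitz[OF pos c])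
  have f_nonneg: "0 \<le> f v" for v unfolding f_def by (rule fluid_wait_nonneg[OF pos c])
  have m_nonneg: "0 \<le> m \<omega>" for \<omega> using m_bounds(1)[of \<omega>] f_nonneg order_trans by blast
  have close: "\<bar>m \<omega> - f x\<bar> \<le> 1 / (\<mu> * (\<eta> * real c)) + \<bar>real (Q \<eta> t \<omega>) / \<eta> - x\<bar> / (\<mu> * real c)" for \<omega> x
  proof -
    have "0 \<le> 1 / (\<mu> * (\<eta> * real c))" using pos c \<eta> by simp
    then show ?thesis
      using m_bounds[of \<omega>] f_lip[of "real (Q \<eta> t \<omega>) / \<eta>" x] unfolding abs_le_iff by linarith
  qed
  have bound_int: "integrable M (\<lambda>\<omega>. 1 / (\<mu> * (\<eta> * real c)) + \<bar>real (Q \<eta> t \<omega>) / \<eta> - x\<bar> / (\<mu> * real c))" for x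
    using Qint by auto
  have m_int: "integrable M m"
  proof (rule Bochner_Integration.integrable_bound)
    show "integrable M (\<lambda>\<omega>. 1 / (\<mu> * (\<eta> * real c)) + \<bar>real (Q \<eta> t \<omega>) / \<eta> - 0\<bar> / (\<mu> * real c) + \<bar>f 0\<bar>)"
      using bound_int[of 0] by auto
    show "AE \<omega> in M. norm (m \<omega>) \<le> norm (1 / (\<mu> * (\<eta> * real c)) + \<bar>real (Q \<eta> t \<omega>) / \<eta> - 0\<bar> / (\<mu> * real c) + \<bar>f 0\<bar>)"
    proof (rule AE_I2)
      fix \<omega>
      show "norm (m \<omega>) \<le> norm (1 / (\<mu> * (\<eta> * real c)) + \<bar>real (Q \<eta> t \<omega>) / \<eta> - 0\<bar> / (\<mu> * real c) + \<bar>f 0\<bar>)"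
        using close[of \<omega> 0] m_nonneg[of \<omega>] unfolding real_norm_def by linarith
    qed
  qed measurable
  \<comment> \<open>Computing the mean in \<open>[0, \<infinity>]\<close> establishes integrability
    of the wait along with its value.\<close>
  have "(\<integral>\<^sup>+ \<omega>. ennreal (W \<eta> t \<omega>) \<partial>M) = (\<integral>\<^sup>+ \<omega>. ennreal (m \<omega>) \<partial>M)"
  proof -
    have s: "0 < \<eta> * real c" using \<eta> c by simp
    have "(\<integral>\<^sup>+ \<omega>. ennreal (W \<eta> t \<omega>) \<partial>M) =
        (\<integral>\<^sup>+ \<omega>. (\<integral>\<^sup>+ x. ennreal x \<partial>virtual_wait_law \<mu> \<theta> (\<eta> * real c) (Q \<eta> t \<omega>)) \<partial>M)"
      by (rule nn_integral_conditional_law)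
        (auto simp: sets_virtual_wait_law W_law \<eta> t
          intro!: prob_space.finite_measure prob_space_virtual_wait_law pos s)
    then show ?thesis by (simp add: nn_integral_virtual_wait_law[OF pos s] m_def)
  qed
  also have "\<dots> = ennreal (expectation m)"
    using m_int m_nonneg by (intro nn_integral_eq_integral) auto
  finally have W: "has_bochner_integral M (W \<eta> t) (expectation m)"
    using W_nonneg[OF \<eta> t] m_nonneg
    by (intro has_bochner_integral_nn_integral) (auto intro!: Bochner_Integration.integral_nonneg)
  then show "integrable M (W \<eta> t)" by (simp add: has_bochner_integral_iff)
  have "\<bar>expectation m - f x\<bar> = \<bar>expectation (\<lambda>\<omega>. m \<omega> - f x)\<bar>"
    using m_int by (simp add: prob_space)
  also have "\<dots> \<le> expectation (\<lambda>\<omega>. \<bar>m \<omega> - f x\<bar>)"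
    by (rule integral_abs_bound)
  also have "\<dots> \<le> expectation (\<lambda>\<omega>. 1 / (\<mu> * (\<eta> * real c)) + \<bar>real (Q \<eta> t \<omega>) / \<eta> - x\<bar> / (\<mu> * real c))"
    by (rule integral_mono[OF _ bound_int]) (use m_int close in auto)
  also have "\<dots> = 1 / (\<mu> * (\<eta> * real c)) + expectation (\<lambda>\<omega>. \<bar>real (Q \<eta> t \<omega>) / \<eta> - x\<bar>) / (\<mu> * real c)"
    using Qint by (simp add: prob_space)
  finally show "\<bar>expectation (W \<eta> t) - fluid_wait \<mu> \<theta> (real c) x\<bar>
      \<le> 1 / (\<mu> * (\<eta> * real c)) + expectation (\<lambda>\<omega>. \<bar>real (Q \<eta> t \<omega>) / \<eta> - x\<bar>) / (\<mu> * real c)"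
    using W by (simp add: has_bochner_integral_iff f_def)
qed

lemma service_mean: "integrable M S" "expectation S = 1 / \<mu>"
  using erlang_ith_moment_integrable[OF rates_pos(2) S_exponential, of 1]
    exponential_distributed_expectation[OF rates_pos(2) S_exponential] by auto

lemma overlap_mean:
  assumes \<eta>: "0 < \<eta>" and t: "0 \<le> t" and Qint: "integrable M (\<lambda>\<omega>. real (Q \<eta> t \<omega>))"
    and Wint: "integrable M (W \<eta> t)"
  shows "expectation (overlap \<eta> t) =
    \<eta> * lam * (1 / \<mu> + expectation (W \<eta> t)) + expectation (\<lambda>\<omega>. real (Q \<eta> t \<omega>))"
proof -
  \<comment> \<open>The arrivals in the window of length \<open>u\<close> after \<open>t\<close>.
    The natural subtraction agrees with the real one because counts increase, so the overlap is
    \<open>F\<close> at the random time \<open>T\<close> plus the queue length.\<close>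
  define F where "F u \<omega> = P 1 (\<eta> * lam * (t + u)) \<omega> - P 1 (\<eta> * lam * t) \<omega>" for u \<omega>
  define T where "T \<omega> = S \<omega> + W \<eta> t \<omega>" for \<omega>
  have r: "0 < \<eta> * lam" using \<eta> rates_pos by simp
  have time: "0 \<le> \<eta> * lam * (t + u)" if "0 \<le> u" for u using r t that by simp
  have time_le: "\<eta> * lam * (t + u) \<le> \<eta> * lam * (t + v)" if "u \<le> v" for u v
    using r that by (intro mult_left_mono) auto
  note P1 = poisson_processD[OF poisson_P(1)]
  have P1t: "P 1 (\<eta> * lam * t) \<omega> \<le> P 1 (\<eta> * lam * (t + u)) \<omega>" if "\<omega> \<in> space M" "0 \<le> u" for \<omega> u
    using P1(3)[OF that(1) time[of 0] time_le[OF that(2)]] by simp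
  have [measurable]: "W \<eta> t \<in> borel_measurable M" by (rule W_measurable[OF \<eta> t])
  have [measurable]: "S \<in> borel_measurable M" using service_mean by auto
  have F_meas: "F u \<in> measurable M (count_space UNIV)" if "0 \<le> u" for u
  proof -
    note [measurable] = P1(1)[OF time[OF that]] P1(1)[OF time[of 0, simplified]]
    show ?thesis unfolding F_def by measurable
  qed
  have "has_bochner_integral M (\<lambda>\<omega>. real (F (T \<omega>) \<omega>)) (\<eta> * lam * expectation T)"
  proof (rule expectation_at_independent_time)
    show "F u \<omega> \<le> F v \<omega>" if "\<omega> \<in> space M" "0 \<le> u" "u \<le> v" for \<omega> u v
      unfolding F_def using P1(3)[OF that(1) time[OF that(2)] time_le[OF that(3)]] by (rule diff_le_mono)
    show "continuous (at_right u) (\<lambda>v. real (F v \<omega>))" if \<omega>: "\<omega> \<in> space M" and u: "0 \<le> u" for \<omega> u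
    proof -
      have lim: "((\<lambda>y. real (P 1 y \<omega>)) \<longlongrightarrow> real (P 1 (\<eta> * lam * (t + u)) \<omega>)) (at_right (\<eta> * lam * (t + u)))"
        using P1(4)[OF \<omega> time[OF u]] by (simp add: continuous_within)
      have "filterlim (\<lambda>v. \<eta> * lam * (t + v)) (at_right (\<eta> * lam * (t + u))) (at_right u)"
        unfolding filterlim_at
      proof
        show "\<forall>\<^sub>F v in at_right u. \<eta> * lam * (t + v) \<in> {\<eta> * lam * (t + u)<..} \<and> \<eta> * lam * (t + v) \<noteq> \<eta> * lam * (t + u)"
          using eventually_at_right_less[of u] by eventually_elim (use \<eta> rates_pos in auto)
      qed (intro tendsto_intros)
      from filterlim_compose[OF lim this]
      have "((\<lambda>v. real (P 1 (\<eta> * lam * (t + v)) \<omega>) - real (P 1 (\<eta> * lam * t) \<omega>)) \<longlongrightarrow>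
          real (P 1 (\<eta> * lam * (t + u)) \<omega>) - real (P 1 (\<eta> * lam * t) \<omega>)) (at_right u)"
        by (intro tendsto_intros)
      moreover have "real (P 1 (\<eta> * lam * (t + v)) \<omega>) - real (P 1 (\<eta> * lam * t) \<omega>) = real (F v \<omega>)" if "0 \<le> v" for v
        using P1t[OF \<omega> that] by (simp add: F_def of_nat_diff)
      ultimately show ?thesis
        unfolding continuous_within using u
        by (auto elim!: Lim_transform_eventually intro!: eventually_mono[OF eventually_at_right_less[of u]])
    qed
    show "(\<integral>\<^sup>+ \<omega>. indicator B (T \<omega>) * ennreal (real (F u \<omega>)) \<partial>M) =
        emeasure M {\<omega> \<in> space M. T \<omega> \<in> B} * ennreal (\<eta> * lam * u)"
      if u: "0 \<le> u" and B: "B \<in> sets borel" for u B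
    proof -
      have "indep_rvs borel (\<lambda>\<omega>. W \<eta> t \<omega>) (count_space UNIV)
          (\<lambda>\<omega>. (\<lambda>x. x u) (\<lambda>u\<in>{0..}. P 1 (\<eta> * lam * (t + u)) \<omega> - P 1 (\<eta> * lam * t) \<omega>))"
        by (rule indep_rvs_compose[OF W_indep_future_arrivals[OF \<eta> t]])
          (use u in \<open>auto intro: measurable_component_singleton\<close>)
      then have WF: "indep_rvs borel (W \<eta> t) (count_space UNIV) (F u)"
        using u by (simp add: F_def[abs_def])
      let ?D = "count_space UNIV \<Otimes>\<^sub>M count_space UNIV \<Otimes>\<^sub>M count_space UNIV \<Otimes>\<^sub>M count_space UNIV \<Otimes>\<^sub>M borel
        :: (nat \<times> nat \<times> nat \<times> nat \<times> real) measure"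
      \<comment> \<open>\<open>S\<close> is independent of the whole family of trajectories;
        \<open>g\<close> reads off the wait at \<open>t\<close> and the arrivals between two
        instants. The first component runs on the unit-rate clock, hence the factor
        \<open>\<eta> * lam\<close> in its arguments.\<close>
      define g :: "(real \<Rightarrow> nat \<times> nat \<times> nat \<times> nat \<times> real) \<Rightarrow> real \<times> nat" where
        "g x = (snd (snd (snd (snd (x t)))), fst (x (\<eta> * lam * (t + u))) - fst (x (\<eta> * lam * t)))" for x
      have "g \<in> measurable (Pi\<^sub>M {0..} (\<lambda>_. ?D)) (borel \<Otimes>\<^sub>M count_space UNIV)"
      proof -
        have [measurable]: "(\<lambda>x. x v) \<in> measurable (Pi\<^sub>M {0..} (\<lambda>_. ?D)) ?D" if "0 \<le> v" for v
          using that by (intro measurable_component_singleton) auto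
        note [measurable] = this[OF time[OF u]] this[OF time[of 0, simplified]] this[OF t]
        show ?thesis unfolding g_def by measurable
      qed
      from indep_rvs_compose[OF S_indep[OF \<eta>] measurable_ident_sets[OF refl] this]
      have SWF: "indep_rvs borel S (borel \<Otimes>\<^sub>M count_space UNIV) (\<lambda>\<omega>. (W \<eta> t \<omega>, F u \<omega>))"
        using time[OF u] time[of 0] t by (simp add: g_def F_def)
      have "(\<integral>\<^sup>+ \<omega>. ennreal (real (F u \<omega>)) \<partial>M) = ennreal (\<eta> * lam * u)"
        using poisson_process_increment_nn_integral(1)[OF poisson_P(1) _ time[of 0] time_le[OF u]]
        by (simp add: F_def algebra_simps)
      with nn_integral_indep_sum[OF SWF WF B, of "\<lambda>k. ennreal (real k)"]
      show ?thesis by (simp add: T_def)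
    qed
    show "integrable M T" unfolding T_def using service_mean Wint by simp
  qed (use r F_meas S_nonneg W_nonneg[OF \<eta> t] in \<open>auto simp: T_def[abs_def]\<close>)
  moreover have "expectation T = 1 / \<mu> + expectation (W \<eta> t)"
    unfolding T_def using service_mean Wint by simp
  moreover have "expectation (overlap \<eta> t) = expectation (\<lambda>\<omega>. real (F (T \<omega>) \<omega>) + real (Q \<eta> t \<omega>))"
  proof (rule Bochner_Integration.integral_cong[OF refl])
    fix \<omega> assume \<omega>: "\<omega> \<in> space M"
    have "0 \<le> T \<omega>" using S_nonneg[OF \<omega>] W_nonneg[OF \<eta> t \<omega>] by (simp add: T_def)
    from P1t[OF \<omega> this] show "overlap \<eta> t \<omega> = real (F (T \<omega>) \<omega>) + real (Q \<eta> t \<omega>)"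
      by (simp add: overlap_def arrivals_def F_def T_def of_nat_diff add.assoc)
  qed
  ultimately show ?thesis using Qint by (simp add: has_bochner_integral_iff)
qed

lemma overlap_limit:
  assumes fluid: "\<And>t. t \<ge> 0 \<Longrightarrow> AE \<omega> in M. ((\<lambda>\<eta>. real (Q \<eta> t \<omega>) / \<eta>) \<longlongrightarrow> q t) at_top"
    and int0: "\<And>\<eta>. \<eta> > 0 \<Longrightarrow> integrable M (\<lambda>\<omega>. real (Q \<eta> 0 \<omega>))"
    and mean0: "((\<lambda>\<eta>. expectation (\<lambda>\<omega>. real (Q \<eta> 0 \<omega>)) / \<eta>) \<longlongrightarrow> q 0) at_top"
    and t: "0 \<le> t"
  shows "((\<lambda>\<eta>. 1 / \<eta> * expectation (overlap \<eta> t)) \<longlongrightarrow>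
    lam / \<mu> + lam * fluid_wait \<mu> \<theta> (real c) (q t) + q t) at_top"
proof -
  let ?d = "\<lambda>\<eta>. expectation (\<lambda>\<omega>. \<bar>real (Q \<eta> t \<omega>) / \<eta> - q t\<bar>)"
  have Qint: "integrable M (\<lambda>\<omega>. real (Q \<eta> t \<omega>))" if "0 < \<eta>" for \<eta>
    using fluid int0 mean0 t that by (rule queue_L1(1))
  have L1: "(?d \<longlongrightarrow> 0) at_top"
    using fluid int0 mean0 t by (rule queue_L1(2))
  have W: "((\<lambda>\<eta>. expectation (W \<eta> t)) \<longlongrightarrow> fluid_wait \<mu> \<theta> (real c) (q t)) at_top"
  proof (rule LIM_zero_cancel, rule Lim_null_comparison)
    show "\<forall>\<^sub>F \<eta> in at_top. norm (expectation (W \<eta> t) - fluid_wait \<mu> \<theta> (real c) (q t))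
        \<le> 1 / (\<mu> * (\<eta> * real c)) + ?d \<eta> / (\<mu> * real c)"
      using eventually_gt_at_top[of 0]
      by eventually_elim (use wait_mean(2)[OF _ t Qint] in auto)
    have "((\<lambda>\<eta>. 1 / (\<mu> * (\<eta> * real c))) \<longlongrightarrow> 0) at_top"
      using rates_pos servers_pos by real_asymp
    from tendsto_add[OF this tendsto_divide_zero[OF L1]]
    show "((\<lambda>\<eta>. 1 / (\<mu> * (\<eta> * real c)) + ?d \<eta> / (\<mu> * real c)) \<longlongrightarrow> 0) at_top" by simp
  qed
  have Q: "((\<lambda>\<eta>. expectation (\<lambda>\<omega>. real (Q \<eta> t \<omega>)) / \<eta>) \<longlongrightarrow> q t) at_top"
  proof (rule LIM_zero_cancel, rule Lim_null_comparison[OF _ L1])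
    show "\<forall>\<^sub>F \<eta> in at_top. norm (expectation (\<lambda>\<omega>. real (Q \<eta> t \<omega>)) / \<eta> - q t) \<le> ?d \<eta>"
      using eventually_gt_at_top[of 0]
    proof eventually_elim
      case (elim \<eta>)
      have "expectation (\<lambda>\<omega>. real (Q \<eta> t \<omega>)) / \<eta> - q t = expectation (\<lambda>\<omega>. real (Q \<eta> t \<omega>) / \<eta> - q t)"
        using Qint[OF elim] by (simp add: prob_space)
      also have "norm \<dots> \<le> ?d \<eta>" unfolding real_norm_def by (rule integral_abs_bound)
      finally show ?case .
    qed
  qed
  have "((\<lambda>\<eta>. lam / \<mu> + lam * expectation (W \<eta> t) + expectation (\<lambda>\<omega>. real (Q \<eta> t \<omega>)) / \<eta>) \<longlongrightarrow>
    lam / \<mu> + lam * fluid_wait \<mu> \<theta> (real c) (q t) + q t) at_top"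
    by (intro tendsto_intros W Q)
  then show ?thesis
  proof (rule Lim_transform_eventually)
    show "\<forall>\<^sub>F \<eta> in at_top. lam / \<mu> + lam * expectation (W \<eta> t) + expectation (\<lambda>\<omega>. real (Q \<eta> t \<omega>)) / \<eta> =
        1 / \<eta> * expectation (overlap \<eta> t)"
      using eventually_gt_at_top[of 0]
    proof eventually_elim
      case (elim \<eta>)
      show ?case
        using overlap_mean[OF elim t Qint[OF elim] wait_mean(1)[OF elim t Qint[OF elim]]] elim
        by (simp add: field_simps)
    qed
  qed
qed

end

theorem theorem3p2:
  fixes M :: "'a measure" and lam \<mu> \<theta> :: real and c :: nat
    and P :: "nat \<Rightarrow> real \<Rightarrow> 'a \<Rightarrow> nat"
    and Q :: "real \<Rightarrow> real \<Rightarrow> 'a \<Rightarrow> nat"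
    and W :: "real \<Rightarrow> real \<Rightarrow> 'a \<Rightarrow> real"
    and S :: "'a \<Rightarrow> real" and q :: "real \<Rightarrow> real"
  assumes model: "scaled_erlang_a M lam \<mu> \<theta> c P Q W S"
    and fluid_limit: "\<And>t. t \<ge> 0 \<Longrightarrow>
      AE \<omega> in M. ((\<lambda>\<eta>. real (Q \<eta> t \<omega>) / \<eta>) \<longlongrightarrow> q t) at_top"
    and initial_integrable: "\<And>\<eta>. \<eta> > 0 \<Longrightarrow> integrable M (\<lambda>\<omega>. real (Q \<eta> 0 \<omega>))"
    and initial_mean: "((\<lambda>\<eta>. (\<integral>\<omega>. real (Q \<eta> 0 \<omega>) \<partial>M) / \<eta>) \<longlongrightarrow> q 0) at_top"
  shows "(\<forall>t\<ge>0. (q has_real_derivative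
            lam - \<mu> * min (q t) (real c) - \<theta> * max (q t - real c) 0) (at t within {0..})) \<and>
         (\<forall>t\<ge>0. ((\<lambda>\<eta>. 1 / \<eta> * (\<integral>\<omega>. scaled_erlang_a.overlap lam P Q W S \<eta> t \<omega> \<partial>M)) \<longlongrightarrow>
            lam / \<mu> + lam / \<theta> * ln (1 + \<theta> * max (q t - real c) 0 / (\<mu> * real c)) + q t) at_top) \<and>
         ((\<lambda>t. Lim at_top (\<lambda>\<eta>. 1 / \<eta> * (\<integral>\<omega>. scaled_erlang_a.overlap lam P Q W S \<eta> t \<omega> \<partial>M))) \<longlongrightarrow>
            (if lam \<le> \<mu> * real c then 2 * lam / \<mu>
             else lam / \<mu> + lam / \<theta> * ln (lam / (\<mu> * real c)) + real c
                  + (lam - \<mu> * real c) / \<theta>)) at_top"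
proof -
  interpret scaled_erlang_a M lam \<mu> \<theta> c P Q W S by (rule model)
  let ?w = "fluid_wait \<mu> \<theta> (real c)"
  have c: "0 < real c" using servers_pos by simp
  have w: "lam * ?w x = lam / \<theta> * ln (1 + \<theta> * max (x - real c) 0 / (\<mu> * real c))" for x
    by (simp add: fluid_wait_def)
  have ode: "(q has_real_derivative lam - erlang_drain \<mu> \<theta> (real c) (q t)) (at t within {0..})" if "0 \<le> t" for t
    using fluid_limit that by (rule fluid_limit_ode)
  have limit: "((\<lambda>\<eta>. 1 / \<eta> * expectation (overlap \<eta> t)) \<longlongrightarrow> lam / \<mu> + lam * ?w (q t) + q t) at_top"
    if "0 \<le> t" for t
    using fluid_limit initial_integrable initial_mean that by (rule overlap_limit)
  \<comment> \<open>The point where drain equals \<open>lam\<close>: either the servers absorb the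
    inflow, or they are saturated and the surplus \<open>lam - \<mu> * c\<close> must abandon at
    rate \<open>\<theta>\<close> per waiting unit.\<close>
  define x where "x = (if lam \<le> \<mu> * real c then lam / \<mu> else real c + (lam - \<mu> * real c) / \<theta>)"
  have x: "erlang_drain \<mu> \<theta> (real c) x = lam"
  proof (cases "lam \<le> \<mu> * real c")
    case True
    then have "lam / \<mu> \<le> real c" using rates_pos by (simp add: field_simps)
    then show ?thesis using True rates_pos by (simp add: x_def erlang_drain_def)
  next
    case False
    then have "0 < (lam - \<mu> * real c) / \<theta>" using rates_pos by simp
    then show ?thesis using False rates_pos by (simp add: x_def erlang_drain_def)
  qed
  have q_lim: "(q \<longlongrightarrow> x) at_top"
  proof (rule tendsto_equilibrium[OF rates_pos(2,3) _ x])
    fix t :: real assume "0 < t"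
    then show "(q has_real_derivative lam - erlang_drain \<mu> \<theta> (real c) (q t)) (at t)"
      using ode[of t] by (simp add: at_within_interior[of t "{0..}"] interior_real_atLeast)
  qed
  \<comment> \<open>Convergence at \<open>nhds x\<close> rather than \<open>at x\<close> is required
    for the composition, since \<open>q\<close> may take the value \<open>x\<close>.\<close>
  have "(?w \<longlongrightarrow> ?w x) (nhds x)"
  proof -
    have "(?w \<longlongrightarrow> ?w x) (at x)"
      unfolding fluid_wait_def using rates_pos c
      by (intro tendsto_intros) (auto simp: add_pos_nonneg intro!: less_imp_neq[THEN not_sym])
    then show ?thesis by (simp add: tendsto_at_iff_tendsto_nhds)
  qed
  from filterlim_compose[OF this q_lim] have "((\<lambda>t. ?w (q t)) \<longlongrightarrow> ?w x) at_top" .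
  then have "((\<lambda>t. lam / \<mu> + lam * ?w (q t) + q t) \<longlongrightarrow> lam / \<mu> + lam * ?w x + x) at_top"
    by (intro tendsto_intros q_lim)
  \<comment> \<open>\<open>Lim\<close> is a choice operator and denotes the limit only where
    convergence is known, here for \<open>t \<ge> 0\<close>.\<close>
  moreover have "\<forall>\<^sub>F t in at_top. lam / \<mu> + lam * ?w (q t) + q t =
      Lim at_top (\<lambda>\<eta>. 1 / \<eta> * expectation (overlap \<eta> t))"
    using eventually_ge_at_top[of 0]
    by eventually_elim (use limit in \<open>auto intro!: tendsto_Lim[symmetric] trivial_limit_at_top_linorder\<close>)
  ultimately have "((\<lambda>t. Lim at_top (\<lambda>\<eta>. 1 / \<eta> * expectation (overlap \<eta> t))) \<longlongrightarrow>
      lam / \<mu> + lam * ?w x + x) at_top"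
    by (rule Lim_transform_eventually)
  also have "lam / \<mu> + lam * ?w x + x = (if lam \<le> \<mu> * real c then 2 * lam / \<mu>
      else lam / \<mu> + lam / \<theta> * ln (lam / (\<mu> * real c)) + real c + (lam - \<mu> * real c) / \<theta>)"
  proof (cases "lam \<le> \<mu> * real c")
    case True
    then have "lam / \<mu> \<le> real c" using rates_pos by (simp add: field_simps)
    then show ?thesis using True by (simp add: x_def fluid_wait_def)
  next
    case False
    then have "0 < (lam - \<mu> * real c) / \<theta>" using rates_pos by simp
    moreover have "1 + (lam - \<mu> * real c) / (\<mu> * real c) = lam / (\<mu> * real c)"
      using rates_pos c by (simp add: field_simps)
    ultimately show ?thesis using False rates_pos by (simp add: x_def w)
  qed
  finally have long_run: "((\<lambda>t. Lim at_top (\<lambda>\<eta>. 1 / \<eta> * expectation (overlap \<eta> t))) \<longlongrightarrow>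
      (if lam \<le> \<mu> * real c then 2 * lam / \<mu>
       else lam / \<mu> + lam / \<theta> * ln (lam / (\<mu> * real c)) + real c + (lam - \<mu> * real c) / \<theta>)) at_top" .
  show ?thesis
    using ode limit long_run by (simp add: w erlang_drain_def diff_diff_eq)
qed

end
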